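(* Let $n \ge 1$ and let $f \in \mathbb{C}[z_1,\ldots,z_n]$ be a polynomial. Then every connected component of the complement $\mathbb{R}^n \setminus \overline{\mathcal{I}(f)}$ of the closure of the imaginary projection of $f$ is convex, and the number of these components is finite.
   Context: For $f \in \mathbb{C}[z_1,\ldots,z_n]$, the imaginary projection of $f$ is $\mathcal{I}(f) = \{\operatorname{Im}(\mathbf{z}) : \mathbf{z} \in \mathbb{C}^n,\ f(\mathbf{z}) = 0\} \subseteq \mathbb{R}^n$, where $\operatorname{Im}(\mathbf{z}) = (\operatorname{Im} z_1,\ldots,\operatorname{Im} z_n)$. The bar denotes the Euclidean closure in $\mathbb{R}^n$. *)

theory Defs
  imports "HOL-Analysis.Analysis" "HOL-Library.Poly_Mapping"
begin

text \<open>Complex polynomials in the variables indexed by the finite type \<open>'n\<close>: a monomial is an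
  exponent vector, and a polynomial is a finitely supported family of coefficients.\<close>

type_synonym 'n cpoly = "('n \<Rightarrow>\<^sub>0 nat) \<Rightarrow>\<^sub>0 complex"

definition eval_cpoly :: "'n::finite cpoly \<Rightarrow> complex ^ 'n \<Rightarrow> complex" where
  "eval_cpoly f z =
     (\<Sum>m\<in>Poly_Mapping.keys f.
        Poly_Mapping.lookup f m * (\<Prod>i\<in>UNIV. (z $ i) ^ Poly_Mapping.lookup m i))"

definition Im_vec :: "complex ^ 'n \<Rightarrow> real ^ 'n" where
  "Im_vec z = (\<chi> i. Im (z $ i))"

definition imaginary_projection :: "'n::finite cpoly \<Rightarrow> (real ^ 'n) set" where
  "imaginary_projection f = {Im_vec z | z. eval_cpoly f z = 0}"

end

theory Submission
  imports Defs "HOL-Computational_Algebra.Fundamental_Theorem_Algebra"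
begin

text \<open>
  Restrict \<open>f\<close> to a complex line \<open>t \<mapsto> f (x + \<i> y + t v)\<close> with \<open>v\<close> real and the top degree form of \<open>f\<close>
  nonzero at \<open>v\<close>. If \<open>y\<close> is outside the imaginary projection, this univariate polynomial of fixed
  degree has no real root, so by continuity of roots its number \<open>N\<^sub>v(y)\<close> of roots in the upper half
  plane does not change as \<open>y\<close> varies in a component \<open>C\<close> and \<open>v\<close> in a connected set. The roots with
  imaginary part in \<open>(0, 1]\<close> are counted by \<open>N\<^sub>v(y) - N\<^sub>v(y + v)\<close>, so if these numbers agree, the segment from
  \<open>y\<close> to \<open>y + v\<close> avoids the imaginary projection. For \<open>y\<close> and \<open>y + v\<close> in the same component this is
  convexity (degenerate directions are handled by perturbation, as components are open), and for
  different components it shows that \<open>C\<close> is determined by the function \<open>v \<mapsto> N\<^sub>v(C)\<close>.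

  That function takes at most finitely many values because the nonvanishing set of a
  polynomial on \<open>\<real>\<^sup>n\<close> has a dense subset with finitely many connected pieces. These are built by
  induction on the number of variables as in cylindrical algebraic decomposition, keeping only the
  open cells: over a set where the degree and the number of distinct complex roots in the last variable
  are constant, the real roots move continuously without colliding.
\<close>

section \<open>Continuity of roots\<close>

text \<open>By the factorization into linear factors, \<open>norm (poly p b)\<close> is the norm of
  the leading coefficient times the product of the distances from \<open>b\<close> to the roots, and
  the nearest root gives the bound. The induction splits off one root and keeps the closer of it and
  the root found for the quotient.\<close>

lemma exists_near_root:
  fixes p :: "complex poly"
  assumes "degree p = Suc d"
  shows "\<exists>a. poly p a = 0 \<and> norm (lead_coeff p) * norm (b - a) ^ Suc d \<le> norm (poly p b)"
  using assms
proof (induction d arbitrary: p)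
  case 0
  then obtain a where a: "poly p a = 0"
    using fundamental_theorem_of_algebra_alt[of p] by (metis degree_pCons_0 nat.distinct(1))
  then obtain q where q: "p = [:-a, 1:] * q"
    using poly_eq_0_iff_dvd by blast
  with 0 have "q \<noteq> 0" by auto
  then have "degree q = 0" using 0 by (simp add: q degree_mult_eq del: mult_pCons_left)
  then obtain c where "q = [:c:]" by (metis degree_eq_zeroE)
  then have "norm (poly p b) = norm c * norm (b - a)" "lead_coeff p = c"
    using \<open>q \<noteq> 0\<close> q by (auto simp: norm_mult [symmetric] algebra_simps)
  then show ?case using a by auto
next
  case (Suc d)
  then obtain a where a: "poly p a = 0"
    using fundamental_theorem_of_algebra_alt[of p] by (metis degree_pCons_0 nat.distinct(1))
  then obtain q where q: "p = [:-a, 1:] * q"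
    using poly_eq_0_iff_dvd by blast
  have "q \<noteq> 0" using Suc.prems q by auto
  then have dq: "degree q = Suc d" using Suc.prems by (simp add: q degree_mult_eq del: mult_pCons_left)
  obtain a' where a': "poly q a' = 0" "norm (lead_coeff q) * norm (b - a') ^ Suc d \<le> norm (poly q b)"
    using Suc.IH[OF dq] by blast
  have lc: "lead_coeff p = lead_coeff q" unfolding q lead_coeff_mult by simp
  have np: "norm (poly p b) = norm (b - a) * norm (poly q b)"
    unfolding q poly_mult by (simp add: norm_mult)
  show ?case
  proof (cases "norm (b - a) \<le> norm (b - a')")
    case True
    have "norm (lead_coeff q) * norm (b - a) ^ Suc (Suc d)
      \<le> norm (b - a) * (norm (lead_coeff q) * norm (b - a') ^ Suc d)"
      using mult_left_mono[OF power_mono[OF True norm_ge_zero, of "Suc d"],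
          of "norm (b - a) * norm (lead_coeff q)"] by (simp add: mult_ac)
    also have "\<dots> \<le> norm (b - a) * norm (poly q b)"
      by (rule mult_left_mono[OF a'(2)]) simp
    finally show ?thesis unfolding lc using a np by auto
  next
    case False
    have "norm (lead_coeff q) * norm (b - a') ^ Suc (Suc d)
      = norm (b - a') * (norm (lead_coeff q) * norm (b - a') ^ Suc d)"
      by simp
    also have "\<dots> \<le> norm (b - a) * norm (poly q b)"
      using False by (intro mult_mono a'(2)) auto
    finally show ?thesis unfolding lc using a'(1) q np by (intro exI[of _ a']) auto
  qed
qed

lemma coeff_synthetic_div_Suc:
  fixes p :: "'a::comm_ring_1 poly"
  shows "coeff (synthetic_div p c) k = coeff p (Suc k) + c * coeff (synthetic_div p c) (Suc k)"
  using arg_cong[OF synthetic_div_correct[of p c], of "\<lambda>r. coeff r (Suc k)"] by simp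

text \<open>The recursion of Horner's scheme expresses each coefficient of the quotient by the next
  higher one, so convergence descends from the indices at or above \<open>d\<close>, where the
  coefficients vanish.\<close>

lemma tendsto_coeff_synthetic_div:
  fixes p :: "'a \<Rightarrow> complex poly"
  assumes "\<And>x. degree (p x) \<le> d" "degree q \<le> d"
    and "\<And>k. ((\<lambda>x. coeff (p x) k) \<longlongrightarrow> coeff q k) F" and "(a \<longlongrightarrow> b) F"
  shows "((\<lambda>x. coeff (synthetic_div (p x) (a x)) k) \<longlongrightarrow> coeff (synthetic_div q b) k) F"
proof (induction "d - k" arbitrary: k)
  case 0
  have *: "coeff (synthetic_div r c) k = 0" if "degree r \<le> d" for r :: "complex poly" and c
  proof (cases "degree r = 0")
    case True
    then have "synthetic_div r c = 0" by (simp add: synthetic_div_eq_0_iff)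
    then show ?thesis by simp
  next
    case False
    with that 0 show ?thesis by (intro coeff_eq_0) (simp add: degree_synthetic_div)
  qed
  show ?case by (simp add: * assms)
next
  case (Suc n)
  then have "n = d - Suc k" by simp
  note IH = Suc.hyps(1)[OF this]
  show ?case
    by (subst (1 2) coeff_synthetic_div_Suc) (intro tendsto_intros assms IH)
qed

lemma tendsto_poly_coeff:
  fixes p :: "'a \<Rightarrow> complex poly"
  assumes "\<And>x. degree (p x) \<le> d" "degree q \<le> d"
    and "\<And>k. ((\<lambda>x. coeff (p x) k) \<longlongrightarrow> coeff q k) F"
  shows "((\<lambda>x. poly (p x) t) \<longlongrightarrow> poly q t) F"
proof -
  have *: "poly r t = (\<Sum>k\<le>d. coeff r k * t ^ k)" if "degree r \<le> d" for r :: "complex poly"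
    unfolding poly_altdef
    by (rule sum.mono_neutral_left) (use that in \<open>auto simp: coeff_eq_0\<close>)
  show ?thesis unfolding *[OF assms(1)] *[OF assms(2)]
    by (intro tendsto_intros assms)
qed

text \<open>The labels \<open>\<alpha> i x\<close> are chosen point by point; the only link between
  different \<open>x\<close> is convergence along \<open>F\<close>. A root \<open>b\<close> of
  \<open>q\<close> attracts a root \<open>a x\<close> of \<open>p x\<close> because
  \<open>poly (p x) b\<close> tends to zero, and the induction continues with the quotients by these
  linear factors.\<close>

lemma roots_tendsto:
  fixes p :: "'a \<Rightarrow> complex poly"
  assumes "\<And>x. degree (p x) = d" "degree q = d" "\<And>x. p x \<noteq> 0" "q \<noteq> 0"
    and "\<And>k. ((\<lambda>x. coeff (p x) k) \<longlongrightarrow> coeff q k) F"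
  obtains \<alpha> \<beta> where
    "\<And>x. p x = smult (lead_coeff (p x)) (\<Prod>i<d. [:- \<alpha> i x, 1:])"
    "q = smult (lead_coeff q) (\<Prod>i<d. [:- \<beta> i, 1:])"
    "\<And>i. i < d \<Longrightarrow> (\<alpha> i \<longlongrightarrow> \<beta> i) F"
proof -
  have "\<exists>\<alpha> \<beta>. (\<forall>x. p x = smult (lead_coeff (p x)) (\<Prod>i<d. [:- \<alpha> i x, 1:])) \<and>
    q = smult (lead_coeff q) (\<Prod>i<d. [:- \<beta> i, 1:]) \<and> (\<forall>i<d. (\<alpha> i \<longlongrightarrow> \<beta> i) F)"
    using assms
  proof (induction d arbitrary: p q)
    case 0
    have "r = smult (lead_coeff r) 1" if "degree r = 0" for r :: "complex poly"
      using degree_0_id[OF that] that by simp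
    with 0 show ?case by auto
  next
    case (Suc d)
    obtain b where b: "poly q b = 0"
      using fundamental_theorem_of_algebra_alt[of q] Suc.prems(2)
      by (metis degree_pCons_0 nat.distinct(1))
    obtain a where a: "\<And>x. poly (p x) (a x) = 0"
      "\<And>x. norm (lead_coeff (p x)) * norm (b - a x) ^ Suc d \<le> norm (poly (p x) b)"
      using exists_near_root[OF Suc.prems(1), of _ b] by metis
    have lq: "coeff q (Suc d) \<noteq> 0" using Suc.prems by (metis leading_coeff_0_iff)
    have lp: "coeff (p x) (Suc d) \<noteq> 0" for x using Suc.prems by (metis leading_coeff_0_iff)
    have pb: "((\<lambda>x. poly (p x) b) \<longlongrightarrow> 0) F"
      using tendsto_poly_coeff[of p "Suc d" q F b] Suc.prems b by simp
    have "((\<lambda>x. norm (poly (p x) b) / norm (coeff (p x) (Suc d)))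
       \<longlongrightarrow> norm (0::complex) / norm (coeff q (Suc d))) F"
      by (intro tendsto_intros pb Suc.prems) (use lq in auto)
    then have lim0: "((\<lambda>x. norm (poly (p x) b) / norm (coeff (p x) (Suc d))) \<longlongrightarrow> 0) F" by simp
    have "((\<lambda>x. norm (b - a x) ^ Suc d) \<longlongrightarrow> 0) F"
    proof (rule tendsto_sandwich[OF _ _ tendsto_const lim0])
      show "\<forall>\<^sub>F x in F. norm (b - a x) ^ Suc d \<le> norm (poly (p x) b) / norm (coeff (p x) (Suc d))"
        using a(2) lp Suc.prems(1) by (auto simp: field_simps)
    qed auto
    from tendsto_real_root[OF this, of "Suc d"]
    have "((\<lambda>x. norm (b - a x)) \<longlongrightarrow> 0) F"
      by (simp add: real_root_power_cancel del: power_Suc)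
    then have lim: "(a \<longlongrightarrow> b) F"
      by (simp add: tendsto_dist_iff[of a] dist_norm norm_minus_commute)
    define p' where "p' x = synthetic_div (p x) (a x)" for x
    define q' where "q' = synthetic_div q b"
    have p: "p x = [:- a x, 1:] * p' x" for x
      using synthetic_div_correct'[of "a x" "p x"] a(1)[of x] by (simp add: p'_def del: mult_pCons_left)
    have q: "q = [:- b, 1:] * q'"
      using synthetic_div_correct'[of b q] b by (simp add: q'_def del: mult_pCons_left)
    have nz: "p' x \<noteq> 0" "q' \<noteq> 0" for x
      using p[of x] q Suc.prems by auto
    have lc: "lead_coeff (p x) = lead_coeff (p' x)" "lead_coeff q = lead_coeff q'" for x
      using lead_coeff_mult[of "[:- a x, 1:]" "p' x"] lead_coeff_mult[of "[:- b, 1:]" q']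
      unfolding p[symmetric] q[symmetric] by simp_all
    have "degree (p' x) = d" "degree q' = d" for x
      by (simp_all add: p'_def q'_def degree_synthetic_div Suc.prems)
    moreover have "((\<lambda>x. coeff (p' x) k) \<longlongrightarrow> coeff q' k) F" for k
      unfolding p'_def q'_def
      by (rule tendsto_coeff_synthetic_div[of _ "Suc d"]) (use Suc.prems lim in auto)
    ultimately obtain \<alpha> \<beta> where \<alpha>:
      "\<And>x. p' x = smult (lead_coeff (p' x)) (\<Prod>i<d. [:- \<alpha> i x, 1:])"
      "q' = smult (lead_coeff q') (\<Prod>i<d. [:- \<beta> i, 1:])"
      "\<And>i. i < d \<Longrightarrow> (\<alpha> i \<longlongrightarrow> \<beta> i) F"
      using Suc.IH[of p' q'] nz by auto
    have "p x = smult (lead_coeff (p x)) (\<Prod>i<Suc d. [:- (\<alpha>(d := a)) i x, 1:])" for x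
    proof -
      have "p x = [:- a x, 1:] * smult (lead_coeff (p x)) (\<Prod>i<d. [:- \<alpha> i x, 1:])"
        unfolding lc using p[of x] \<alpha>(1)[of x] by simp
      also have "\<dots> = smult (lead_coeff (p x)) (\<Prod>i<Suc d. [:- (\<alpha>(d := a)) i x, 1:])"
        by (simp add: mult.commute del: mult_pCons_left mult_pCons_right)
      finally show ?thesis .
    qed
    moreover have "q = smult (lead_coeff q) (\<Prod>i<Suc d. [:- (\<beta>(d := b)) i, 1:])"
    proof -
      have "q = [:- b, 1:] * smult (lead_coeff q) (\<Prod>i<d. [:- \<beta> i, 1:])"
        unfolding lc using q \<alpha>(2) by simp
      also have "\<dots> = smult (lead_coeff q) (\<Prod>i<Suc d. [:- (\<beta>(d := b)) i, 1:])"
        by (simp add: mult.commute del: mult_pCons_left mult_pCons_right)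
      finally show ?thesis .
    qed
    moreover have "((\<alpha>(d := a)) i \<longlongrightarrow> (\<beta>(d := b)) i) F" if "i < Suc d" for i
      using that \<alpha>(3)[of i] lim by (cases "i = d") auto
    ultimately show ?case by blast
  qed
  with that show ?thesis by blast
qed

section \<open>Root counts in half planes\<close>

text \<open>Counting with multiplicity keeps the number stable when roots collide off the line
  \<open>Im z = h\<close>.\<close>

definition roots_above :: "real \<Rightarrow> complex poly \<Rightarrow> nat" where
  "roots_above h p = size (filter_mset (\<lambda>z. h < Im z) (proots p))"

lemma proots_smult_prod:
  fixes c :: "'a::idom"
  assumes "c \<noteq> 0"
  shows "proots (smult c (\<Prod>i<d. [:- \<alpha> i, 1:])) = image_mset \<alpha> (mset_set {..<(d::nat)})"
proof -
  have "proots (\<Prod>i<d. [:- \<alpha> i, 1:]) = (\<Sum>i<d. {#\<alpha> i#})"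
    by (subst proots_prod) auto
  also have "\<dots> = image_mset \<alpha> (mset_set {..<d})"
    by (induction d) (auto simp: lessThan_Suc)
  finally show ?thesis using assms by simp
qed

lemma roots_above_smult_prod:
  assumes "c \<noteq> 0"
  shows "roots_above h (smult c (\<Prod>i<d. [:- \<alpha> i, 1:])) = card {i::nat. i < d \<and> h < Im (\<alpha> i)}"
  unfolding roots_above_def proots_smult_prod[OF assms]
  by (simp add: filter_mset_image_mset)

lemma roots_above_le: "roots_above h p \<le> degree p"
  unfolding roots_above_def
  using size_filter_mset_lesseq[of _ "proots p"] size_proots_complex[of p] by metis

text \<open>No limit root lies on the line \<open>Im z = h\<close>, so each of the finitely many
  labelled roots eventually stays on the side of its limit.\<close>

lemma roots_above_locally_constant:
  fixes p :: "'a \<Rightarrow> complex poly"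
  assumes "\<And>x. degree (p x) = d" "degree q = d" "\<And>x. p x \<noteq> 0" "q \<noteq> 0"
    and "\<And>k. ((\<lambda>x. coeff (p x) k) \<longlongrightarrow> coeff q k) F"
    and noroot: "\<And>z. poly q z = 0 \<Longrightarrow> Im z \<noteq> h"
  shows "\<forall>\<^sub>F x in F. roots_above h (p x) = roots_above h q"
proof -
  obtain \<alpha> \<beta> where \<alpha>: "\<And>x. p x = smult (lead_coeff (p x)) (\<Prod>i<d. [:- \<alpha> i x, 1:])"
    "q = smult (lead_coeff q) (\<Prod>i<d. [:- \<beta> i, 1:])"
    and lim: "\<And>i. i < d \<Longrightarrow> (\<alpha> i \<longlongrightarrow> \<beta> i) F"
    using roots_tendsto[OF assms(1-5)] by blast
  have "\<forall>\<^sub>F x in F. (h < Im (\<alpha> i x)) = (h < Im (\<beta> i))" if i: "i < d" for i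
  proof -
    have "poly q (\<beta> i) = 0" by (subst \<alpha>(2)) (use i in \<open>auto simp: poly_prod\<close>)
    then have "Im (\<beta> i) \<noteq> h" using noroot by blast
    moreover have "((\<lambda>x. Im (\<alpha> i x)) \<longlongrightarrow> Im (\<beta> i)) F"
      by (intro tendsto_intros lim i)
    ultimately show ?thesis
      using order_tendstoD[of "\<lambda>x. Im (\<alpha> i x)" "Im (\<beta> i)" F h]
      by (cases "h < Im (\<beta> i)") (auto elim!: eventually_mono)
  qed
  then have "\<forall>\<^sub>F x in F. \<forall>i\<in>{..<d}. (h < Im (\<alpha> i x)) = (h < Im (\<beta> i))"
    by (intro eventually_ball_finite) auto
  then show ?thesis
  proof eventually_elim
    case (elim x)
    have "roots_above h (p x) = card {i. i < d \<and> h < Im (\<alpha> i x)}"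
      using roots_above_smult_prod[of "lead_coeff (p x)" h "\<lambda>i. \<alpha> i x" d] assms(3)[of x]
      unfolding \<alpha>(1)[symmetric] leading_coeff_0_iff by blast
    also have "\<dots> = card {i. i < d \<and> h < Im (\<beta> i)}"
      using elim by (intro arg_cong[of _ _ card]) auto
    also have "\<dots> = roots_above h q"
      using roots_above_smult_prod[of "lead_coeff q" h \<beta> d] assms(4)
      unfolding \<alpha>(2)[symmetric] leading_coeff_0_iff by metis
    finally show ?case .
  qed
qed

lemma roots_above_pcompose_shift:
  fixes p :: "complex poly"
  assumes "p \<noteq> 0"
  shows "roots_above h (pcompose p [:\<i>, 1:]) = roots_above (h + 1) p"
proof -
  \<comment> \<open>The constant family over \<open>unit\<close> with the filter \<open>bot\<close>
    turns \<open>roots_tendsto\<close> into the factorization of a single polynomial.\<close>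
  obtain \<alpha> where \<alpha>: "p = smult (lead_coeff p) (\<Prod>i<degree p. [:- \<alpha> i, 1:])"
    using roots_tendsto[of "\<lambda>_::unit. p" "degree p" p bot] assms by auto
  define d c where "d = degree p" and "c = lead_coeff p"
  have c: "c \<noteq> 0" and p: "p = smult c (\<Prod>i<d. [:- \<alpha> i, 1:])"
    using assms \<alpha> by (simp_all add: c_def d_def)
  have *: "pcompose p [:\<i>, 1:] = smult c (\<Prod>i<d. [:- (\<alpha> i - \<i>), 1:])"
    by (simp add: p pcompose_smult pcompose_prod pcompose_pCons add.commute)
  have "roots_above (h + 1) p = card {i. i < d \<and> h + 1 < Im (\<alpha> i)}"
    unfolding p by (rule roots_above_smult_prod[OF c])
  then show ?thesis
    unfolding * roots_above_smult_prod[OF c] by (simp add: less_diff_eq)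
qed

text \<open>The roots above \<open>b\<close> form a submultiset of those above \<open>a\<close>;
  equal sizes make the two equal, and a root in the strip would belong only to the larger
  one.\<close>

lemma roots_above_eq_imp_no_root:
  fixes p :: "complex poly"
  assumes "p \<noteq> 0" "roots_above a p = roots_above b p" "a < Im z" "Im z \<le> b"
  shows "poly p z \<noteq> 0"
proof
  assume z: "poly p z = 0"
  define M where "M = filter_mset (\<lambda>z. a < Im z) (proots p)"
  define M' where "M' = filter_mset (\<lambda>z. b < Im z) (proots p)"
  have sub: "M' \<subseteq># M"
    unfolding M_def M'_def using assms(3,4) by (intro filter_mset_mono_strong) auto
  moreover have "size M' = size M" using assms(2) by (simp add: M_def M'_def roots_above_def)
  ultimately have "M' = M" using mset_subset_size by (metis subset_mset.le_imp_less_or_eq less_irrefl)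
  moreover have "z \<in># M" "z \<notin># M'"
    using z assms by (auto simp: M_def M'_def)
  ultimately show False by simp
qed

section \<open>Stability of real roots\<close>

text \<open>A constant number of distinct roots forbids collisions in the limit. A non-real root
  with a real limit would collide there with its conjugate, which is also a root, while real roots
  have real limits; the condition on \<open>frontier U\<close> stops real roots from entering or
  leaving \<open>U\<close>.\<close>

lemma card_real_roots_locally_constant:
  fixes p :: "'a \<Rightarrow> complex poly"
  assumes "\<And>x. degree (p x) = d" "degree q = d" "\<And>x. p x \<noteq> 0" "q \<noteq> 0"
    and "\<And>k. ((\<lambda>x. coeff (p x) k) \<longlongrightarrow> coeff q k) F"
    and card_eq: "\<And>x. card {z. poly (p x) z = 0} = card {z. poly q z = 0}"
    and cnj_closed: "\<And>x z. poly (p x) z = 0 \<Longrightarrow> poly (p x) (cnj z) = 0"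
    and U: "\<And>t. t \<in> frontier U \<Longrightarrow> poly q (of_real t) \<noteq> 0"
  shows "\<forall>\<^sub>F x in F. card {s \<in> U. poly (p x) (of_real s) = 0}
    = card {s \<in> U. poly q (of_real s) = 0}"
proof -
  obtain \<alpha> \<beta> where \<alpha>: "\<And>x. p x = smult (lead_coeff (p x)) (\<Prod>i<d. [:- \<alpha> i x, 1:])"
    "q = smult (lead_coeff q) (\<Prod>i<d. [:- \<beta> i, 1:])"
    and lim: "\<And>i. i < d \<Longrightarrow> (\<alpha> i \<longlongrightarrow> \<beta> i) F"
    using roots_tendsto[OF assms(1-5)] by blast
  have rp: "{z. poly (p x) z = 0} = (\<lambda>i. \<alpha> i x) ` {..<d}" for x
  proof -
    have "lead_coeff (p x) \<noteq> 0" unfolding leading_coeff_0_iff by (rule assms)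
    then show ?thesis by (subst \<alpha>(1)) (auto simp: poly_prod simp del: leading_coeff_0_iff)
  qed
  have rq: "{z. poly q z = 0} = \<beta> ` {..<d}"
  proof -
    have "lead_coeff q \<noteq> 0" unfolding leading_coeff_0_iff by (rule assms)
    then show ?thesis by (subst \<alpha>(2)) (auto simp: poly_prod simp del: leading_coeff_0_iff)
  qed
  have ne: "\<forall>\<^sub>F x in F. f x \<noteq> g x" if "(f \<longlongrightarrow> a) F" "(g \<longlongrightarrow> b) F" "a \<noteq> b"
    for f g :: "'a \<Rightarrow> complex" and a b
  proof -
    have "((\<lambda>x. f x - g x) \<longlongrightarrow> a - b) F" by (intro tendsto_intros that)
    from tendsto_imp_eventually_ne[OF this, of 0] that(3) show ?thesis by simp
  qed
  have ev1: "\<forall>\<^sub>F x in F. \<forall>i\<in>{..<d}. \<forall>j\<in>{..<d}. \<alpha> i x = \<alpha> j x \<longrightarrow> \<beta> i = \<beta> j"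
    by (intro eventually_ball_finite ballI finite_lessThan, rename_tac i j,
        case_tac "\<beta> i = \<beta> j") (auto elim!: eventually_mono[OF ne[OF lim lim]])
  have ev2: "\<forall>\<^sub>F x in F. \<forall>i\<in>{..<d}. \<forall>j\<in>{..<d}. \<alpha> j x = cnj (\<alpha> i x) \<longrightarrow> \<beta> j = cnj (\<beta> i)"
    by (intro eventually_ball_finite ballI finite_lessThan, rename_tac i j,
        case_tac "\<beta> j = cnj (\<beta> i)")
      (auto elim!: eventually_mono[OF ne[OF lim tendsto_cnj[OF lim]]])
  have ev3: "\<forall>\<^sub>F x in F. \<forall>i\<in>{..<d}. Re (\<beta> i) \<notin> frontier U \<longrightarrow> (Re (\<alpha> i x) \<in> U \<longleftrightarrow> Re (\<beta> i) \<in> U)"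
  proof (intro eventually_ball_finite ballI finite_lessThan)
    fix i assume i: "i \<in> {..<d}"
    have lim': "((\<lambda>x. Re (\<alpha> i x)) \<longlongrightarrow> Re (\<beta> i)) F" by (intro tendsto_intros lim) (use i in auto)
    show "\<forall>\<^sub>F x in F. Re (\<beta> i) \<notin> frontier U \<longrightarrow> (Re (\<alpha> i x) \<in> U \<longleftrightarrow> Re (\<beta> i) \<in> U)"
    proof (cases "Re (\<beta> i) \<in> frontier U")
      case False
      then consider "Re (\<beta> i) \<in> interior U" | "Re (\<beta> i) \<in> - closure U"
        by (auto simp: frontier_def)
      then show ?thesis
      proof cases
        case 1
        with topological_tendstoD[OF lim' open_interior 1] show ?thesis
          using interior_subset[of U] by (auto elim!: eventually_mono)
      next
        case 2
        with topological_tendstoD[OF lim' open_Compl[OF closed_closure] 2] show ?thesis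
          using closure_subset[of U] by (auto elim!: eventually_mono)
      qed
    qed simp
  qed
  show ?thesis using ev1 ev2 ev3
  proof eventually_elim
    case (elim x)
    define A where "A = (\<lambda>i. \<alpha> i x) ` {..<d}"
    define B where "B = \<beta> ` {..<d}"
    have cAB: "card A = card B" using card_eq[of x] by (simp add: rp rq A_def B_def)
    \<comment> \<open>\<open>g\<close> sends a root of \<open>p x\<close> to its limit; the first
      eventual property makes the choice of the label by \<open>SOME\<close> irrelevant.\<close>
    define g where "g z = \<beta> (SOME i. i < d \<and> \<alpha> i x = z)" for z
    have g: "g (\<alpha> i x) = \<beta> i" if "i < d" for i
    proof -
      have "(SOME j. j < d \<and> \<alpha> j x = \<alpha> i x) < d \<and> \<alpha> (SOME j. j < d \<and> \<alpha> j x = \<alpha> i x) x = \<alpha> i x"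
        by (rule someI[of _ i]) (use that in auto)
      then show ?thesis unfolding g_def using elim(1) that by (metis lessThan_iff)
    qed
    have gA: "g ` A = B" unfolding A_def B_def image_image by (intro image_cong) (auto simp: g)
    \<comment> \<open>A surjection between finite sets of equal size is injective: this is where the
      constant number of distinct roots enters.\<close>
    have "inj_on g A"
      by (rule eq_card_imp_inj_on) (auto simp: gA cAB, simp add: A_def)
    have inj: "\<alpha> i x = \<alpha> j x" if "i < d" "j < d" "\<beta> i = \<beta> j" for i j
      by (rule inj_onD[OF \<open>inj_on g A\<close>]) (use that g in \<open>auto simp: A_def\<close>)
    have real_iff: "Im (\<alpha> i x) = 0 \<longleftrightarrow> Im (\<beta> i) = 0" if i: "i < d" for i
    proof -
      have "\<alpha> i x \<in> {z. poly (p x) z = 0}" unfolding rp using i by blast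
      then have "cnj (\<alpha> i x) \<in> {z. poly (p x) z = 0}" using cnj_closed by blast
      then obtain j where j: "j < d" "\<alpha> j x = cnj (\<alpha> i x)" unfolding rp by (metis imageE lessThan_iff)
      have bj: "\<beta> j = cnj (\<beta> i)" using elim(2) i j by blast
      have "\<alpha> i x = cnj (\<alpha> i x) \<longleftrightarrow> \<beta> i = cnj (\<beta> i)"
      proof
        assume "\<alpha> i x = cnj (\<alpha> i x)"
        then have "\<alpha> i x = \<alpha> j x" using j by simp
        then have "\<beta> i = \<beta> j" using elim(1) i j(1) by blast
        then show "\<beta> i = cnj (\<beta> i)" using bj by simp
      next
        assume "\<beta> i = cnj (\<beta> i)"
        then have "\<alpha> i x = \<alpha> j x" using inj[OF i j(1)] bj by simp
        then show "\<alpha> i x = cnj (\<alpha> i x)" using j(2) by simp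
      qed
      then show ?thesis by (simp add: complex_eq_iff)
    qed
    have re_ne: "Re (\<beta> i) \<notin> frontier U" if "i < d" "Im (\<beta> i) = 0" for i
    proof
      assume t: "Re (\<beta> i) \<in> frontier U"
      have "\<beta> i = of_real (Re (\<beta> i))" using that by (simp add: complex_eq_iff)
      moreover have "\<beta> i \<in> {z. poly q z = 0}" unfolding rq using that by blast
      ultimately show False using U[OF t] by simp
    qed
    define A' where "A' = {z \<in> A. Im z = 0 \<and> Re z \<in> U}"
    define B' where "B' = {z \<in> B. Im z = 0 \<and> Re z \<in> U}"
    have "g ` A' = B'"
    proof (intro equalityI subsetI)
      fix z assume "z \<in> g ` A'"
      then obtain i where i: "i < d" "z = \<beta> i" "Im (\<alpha> i x) = 0" "Re (\<alpha> i x) \<in> U"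
        using g by (auto simp: A'_def A_def)
      then have "Im (\<beta> i) = 0" using real_iff[OF i(1)] by simp
      moreover from this have "Re (\<beta> i) \<in> U"
        using re_ne[OF i(1)] elim(3) i(1,4) by blast
      ultimately show "z \<in> B'" using i by (simp add: B'_def B_def)
    next
      fix z assume "z \<in> B'"
      then obtain i where i: "i < d" "z = \<beta> i" "Im (\<beta> i) = 0" "Re (\<beta> i) \<in> U"
        by (auto simp: B'_def B_def)
      then have "\<alpha> i x \<in> A'"
      proof -
        have "Re (\<alpha> i x) \<in> U" using re_ne[OF i(1,3)] elim(3) i(1,4) by blast
        then show ?thesis using real_iff[OF i(1)] i by (simp add: A'_def A_def)
      qed
      then show "z \<in> g ` A'" using g[OF i(1)] i(2) by (metis imageI)
    qed
    moreover have "inj_on g A'"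
      using \<open>inj_on g A\<close> by (rule inj_on_subset) (auto simp: A'_def)
    ultimately have "card A' = card B'" by (metis card_image)
    moreover have conv: "card {s \<in> U. poly r (of_real s) = 0}
      = card {z \<in> {z. poly r z = 0}. Im z = 0 \<and> Re z \<in> U}" for r :: "complex poly"
    proof -
      have "complex_of_real ` {s \<in> U. poly r (of_real s) = 0}
        = {z \<in> {z. poly r z = 0}. Im z = 0 \<and> Re z \<in> U}"
      proof (intro equalityI subsetI)
        fix z assume z: "z \<in> {z \<in> {z. poly r z = 0}. Im z = 0 \<and> Re z \<in> U}"
        then have "z = of_real (Re z)" by (simp add: complex_eq_iff)
        with z show "z \<in> complex_of_real ` {s \<in> U. poly r (of_real s) = 0}" by force
      qed auto
      moreover have "card (complex_of_real ` S) = card S" for S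
        by (rule card_image) (simp add: inj_on_def)
      ultimately show ?thesis by metis
    qed
    ultimately show ?case
      unfolding conv rp rq A'_def B'_def A_def B_def by simp
  qed
qed

section \<open>Cells of the complement of an algebraic set\<close>

text \<open>The variables are real and the coefficients complex, and all functions live on the same
  space. Restricting the admissible variables to \<open>I\<close> allows induction on their number
  without changing the type.\<close>

inductive polyf :: "'n set \<Rightarrow> (real ^ 'n \<Rightarrow> complex) \<Rightarrow> bool" for I :: "'n::finite set" where
  polyf_const: "polyf I (\<lambda>x. c)"
| polyf_var: "i \<in> I \<Longrightarrow> polyf I (\<lambda>x. of_real (x $ i))"
| polyf_add: "polyf I p \<Longrightarrow> polyf I q \<Longrightarrow> polyf I (\<lambda>x. p x + q x)"
| polyf_mult: "polyf I p \<Longrightarrow> polyf I q \<Longrightarrow> polyf I (\<lambda>x. p x * q x)"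

lemma polyf_diff: "polyf I p \<Longrightarrow> polyf I q \<Longrightarrow> polyf I (\<lambda>x. p x - q x)"
  using polyf_add[OF _ polyf_mult[OF polyf_const[of _ "-1"]], of I p q] by simp

lemma polyf_sum:
  "finite A \<Longrightarrow> (\<And>a. a \<in> A \<Longrightarrow> polyf I (f a)) \<Longrightarrow> polyf I (\<lambda>x. \<Sum>a\<in>A. f a x)"
  by (induction A rule: finite_induct) (auto intro: polyf_const polyf_add)

lemma polyf_prod:
  "finite A \<Longrightarrow> (\<And>a. a \<in> A \<Longrightarrow> polyf I (f a)) \<Longrightarrow> polyf I (\<lambda>x. \<Prod>a\<in>A. f a x)"
  by (induction A rule: finite_induct) (auto intro: polyf_const polyf_mult)

lemma polyf_power: "polyf I p \<Longrightarrow> polyf I (\<lambda>x. p x ^ n)"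
  by (induction n) (auto intro: polyf_const polyf_mult)

lemma polyf_if: "(b \<Longrightarrow> polyf I p) \<Longrightarrow> (\<not> b \<Longrightarrow> polyf I q) \<Longrightarrow> polyf I (\<lambda>x. if b then p x else q x)"
  by (cases b) auto

lemma polyf_cnj: "polyf I p \<Longrightarrow> polyf I (\<lambda>x. cnj (p x))"
  by (induction rule: polyf.induct) (auto intro: polyf.intros)

lemma continuous_on_polyf: "polyf I p \<Longrightarrow> continuous_on S p"
  by (induction rule: polyf.induct) (auto intro!: continuous_intros)

lemma polyf_cong: "polyf I p \<Longrightarrow> (\<And>l. l \<in> I \<Longrightarrow> x $ l = y $ l) \<Longrightarrow> p x = p y"
  by (induction rule: polyf.induct) auto

lemma polyf_coeff_mult:
  assumes "\<And>k. polyf I (\<lambda>x. coeff (A x) k)" "\<And>k. polyf I (\<lambda>x. coeff (B x) k)"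
  shows "polyf I (\<lambda>x. coeff (A x * B x) k)"
  unfolding coeff_mult by (intro polyf_sum polyf_mult assms finite_atMost)

text \<open>Collecting powers of \<open>x $ i\<close> turns the function into a univariate
  polynomial whose coefficients are polynomial functions of the variables in \<open>I\<close>. The
  uniform bound \<open>D\<close> later allows a point of maximal degree to be picked.\<close>

lemma polyf_insert_expand:
  assumes "polyf (insert i I) p"
  obtains A D where "\<And>k. polyf I (\<lambda>x. coeff (A x) k)" "\<And>x. degree (A x) \<le> D"
    "\<And>x. p x = poly (A x) (of_real (x $ i))"
proof -
  have "\<exists>A D. (\<forall>k. polyf I (\<lambda>x. coeff (A x) k)) \<and> (\<forall>x. degree (A x) \<le> D) \<and>
    (\<forall>x. p x = poly (A x) (of_real (x $ i)))"
    using assms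
  proof (induction rule: polyf.induct)
    case (polyf_const c)
    show ?case
      by (rule exI[of _ "\<lambda>x. [:c:]"], rule exI[of _ 0]) (auto intro: polyf.intros)
  next
    case (polyf_var l)
    show ?case
    proof (cases "l = i")
      case True
      show ?thesis
        by (rule exI[of _ "\<lambda>x. [:0, 1:]"], rule exI[of _ 1]) (auto intro: polyf.intros simp: True)
    next
      case False
      then have l: "l \<in> I" using polyf_var by auto
      have "polyf I (\<lambda>x. coeff [:complex_of_real (x $ l):] k)" for k
        by (cases k) (auto intro: polyf.intros l)
      then show ?thesis
        by (intro exI[of _ "\<lambda>x. [:of_real (x $ l):]"] exI[of _ 0]) auto
    qed
  next
    case (polyf_add p q)
    from polyf_add.IH(1) obtain A D where A: "\<And>k. polyf I (\<lambda>x. coeff (A x) k)"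
      "\<And>x. degree (A x) \<le> D" "\<And>x. p x = poly (A x) (of_real (x $ i))" by blast
    from polyf_add.IH(2) obtain B E where B: "\<And>k. polyf I (\<lambda>x. coeff (B x) k)"
      "\<And>x. degree (B x) \<le> E" "\<And>x. q x = poly (B x) (of_real (x $ i))" by blast
    have "polyf I (\<lambda>x. coeff (A x + B x) k)" for k
      unfolding coeff_add by (intro polyf.polyf_add A B)
    moreover have "degree (A x + B x) \<le> max D E" for x
      by (intro degree_add_le max.coboundedI1 A(2) max.coboundedI2 B(2))
    ultimately show ?case
      by (intro exI[of _ "\<lambda>x. A x + B x"] exI[of _ "max D E"]) (simp add: A(3) B(3))
  next
    case (polyf_mult p q)
    from polyf_mult.IH(1) obtain A D where A: "\<And>k. polyf I (\<lambda>x. coeff (A x) k)"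
      "\<And>x. degree (A x) \<le> D" "\<And>x. p x = poly (A x) (of_real (x $ i))" by blast
    from polyf_mult.IH(2) obtain B E where B: "\<And>k. polyf I (\<lambda>x. coeff (B x) k)"
      "\<And>x. degree (B x) \<le> E" "\<And>x. q x = poly (B x) (of_real (x $ i))" by blast
    have "polyf I (\<lambda>x. coeff (A x * B x) k)" for k by (intro polyf_coeff_mult A B)
    moreover have "degree (A x * B x) \<le> D + E" for x
      using degree_mult_le[of "A x" "B x"] A(2)[of x] B(2)[of x] by linarith
    ultimately show ?case
      by (intro exI[of _ "\<lambda>x. A x * B x"] exI[of _ "D + E"]) (simp add: A(3) B(3))
  qed
  with that show ?thesis by blast
qed

section \<open>Linear independence and the number of distinct roots\<close>

definition poly_indep :: "nat \<Rightarrow> (nat \<Rightarrow> 'a::comm_ring_1 poly) \<Rightarrow> bool" where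
  "poly_indep m v \<longleftrightarrow> (\<forall>a. (\<Sum>i<m. smult (a i) (v i)) = 0 \<longrightarrow> (\<forall>i<m. a i = 0))"

lemma smult_sum_right: "smult c (\<Sum>i\<in>A. f i) = (\<Sum>i\<in>A. smult c (f i))"
  by (induction A rule: infinite_finite_induct) (auto simp: smult_add_right)

text \<open>One step of Gaussian elimination with pivot \<open>coeff (v m) r\<close>.
  Cross-multiplication replaces division, so that entries which are polynomial functions of a
  parameter remain so.\<close>

lemma poly_indep_eliminate:
  fixes v :: "nat \<Rightarrow> complex poly"
  assumes nz: "coeff (v m) r \<noteq> 0"
  shows "poly_indep (Suc m) v \<longleftrightarrow>
    poly_indep m (\<lambda>i. smult (coeff (v m) r) (v i) - smult (coeff (v i) r) (v m))" (is "_ \<longleftrightarrow> poly_indep m ?w")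
proof -
  define c where "c i = coeff (v i) r" for i
  have expand: "(\<Sum>i<n. smult (a i) (?w i))
    = smult (c m) (\<Sum>i<n. smult (a i) (v i)) - smult (\<Sum>i<n. a i * c i) (v m)" for a n
    unfolding c_def
    by (induction n) (auto simp: algebra_simps smult_diff_right smult_add_left smult_add_right)
  show ?thesis
  proof
    assume ind: "poly_indep (Suc m) v"
    show "poly_indep m ?w"
      unfolding poly_indep_def
    proof (intro allI impI)
      fix a i assume 0: "(\<Sum>i<m. smult (a i) (?w i)) = 0" and i: "i < m"
      define b where "b j = (if j < m then c m * a j else - (\<Sum>i<m. a i * c i))" for j
      have "(\<Sum>j<Suc m. smult (b j) (v j)) = (\<Sum>i<m. smult (a i) (?w i))"
        unfolding expand by (simp add: b_def smult_sum_right)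
      then have "b i = 0" using ind 0 i by (simp add: poly_indep_def)
      then show "a i = 0" using nz i by (simp add: b_def c_def)
    qed
  next
    assume ind: "poly_indep m ?w"
    show "poly_indep (Suc m) v"
      unfolding poly_indep_def
    proof (intro allI impI)
      fix a i assume 0: "(\<Sum>i<Suc m. smult (a i) (v i)) = 0" and i: "i < Suc m"
      then have *: "(\<Sum>i<m. smult (a i) (v i)) = - smult (a m) (v m)"
        by (simp add: eq_neg_iff_add_eq_0)
      from arg_cong[OF this, of "\<lambda>p. coeff p r"] have "(\<Sum>i<m. a i * c i) = - a m * c m"
        by (simp add: coeff_sum c_def)
      with * expand[of a m] have "(\<Sum>i<m. smult (a i) (?w i)) = 0"
        by (simp add: mult.commute)
      with ind have a: "\<forall>i<m. a i = 0" by (simp add: poly_indep_def)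
      then have "smult (a m) (v m) = 0" using * by simp
      moreover have "v m \<noteq> 0" using nz by auto
      ultimately have "a m = 0" by simp
      with a i show "a i = 0" by (metis less_Suc_eq)
    qed
  qed
qed

text \<open>The elimination that succeeds at \<open>x0\<close> succeeds wherever all its pivots are
  nonzero, and \<open>Q\<close> is the product of these pivots.\<close>

lemma poly_indep_generic:
  assumes "\<And>i k. polyf I (\<lambda>x. coeff (v i x) k)" and "poly_indep m (\<lambda>i. v i x0)"
  obtains Q where "polyf I Q" "Q x0 \<noteq> 0" "\<And>x. Q x \<noteq> 0 \<Longrightarrow> poly_indep m (\<lambda>i. v i x)"
proof -
  have "\<exists>Q. polyf I Q \<and> Q x0 \<noteq> 0 \<and> (\<forall>x. Q x \<noteq> 0 \<longrightarrow> poly_indep m (\<lambda>i. v i x))"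
    using assms
  proof (induction m arbitrary: v)
    case 0
    show ?case by (rule exI[of _ "\<lambda>_. 1"]) (auto intro: polyf_const simp: poly_indep_def)
  next
    case (Suc m)
    have "v m x0 \<noteq> 0"
    proof
      assume "v m x0 = 0"
      then have "(\<Sum>i<Suc m. smult (if i = m then 1 else 0) (v i x0)) = 0" by simp
      with Suc.prems(2)[unfolded poly_indep_def, rule_format, of "\<lambda>i. if i = m then 1 else 0" m]
      show False by simp
    qed
    then obtain r where r: "coeff (v m x0) r \<noteq> 0" by (metis leading_coeff_0_iff)
    define w where "w i x = smult (coeff (v m x) r) (v i x) - smult (coeff (v i x) r) (v m x)" for i x
    have "polyf I (\<lambda>x. coeff (w i x) k)" for i k
      unfolding w_def coeff_diff coeff_smult by (intro polyf_diff polyf_mult Suc.prems)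
    moreover have "poly_indep m (\<lambda>i. w i x0)"
      using Suc.prems(2) poly_indep_eliminate[of "\<lambda>i. v i x0" m r] r by (simp add: w_def)
    ultimately obtain Q where Q: "polyf I Q" "Q x0 \<noteq> 0" "\<And>x. Q x \<noteq> 0 \<Longrightarrow> poly_indep m (\<lambda>i. w i x)"
      using Suc.IH[of w] by blast
    have "polyf I (\<lambda>x. Q x * coeff (v m x) r)" by (intro polyf_mult Q Suc.prems)
    moreover have "poly_indep (Suc m) (\<lambda>i. v i x)" if "Q x * coeff (v m x) r \<noteq> 0" for x
      using Q(3)[of x] that poly_indep_eliminate[of "\<lambda>i. v i x" m r] by (simp add: w_def)
    ultimately show ?case using Q(2) r by (intro exI[of _ "\<lambda>x. Q x * coeff (v m x) r"]) auto
  qed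
  with that show ?thesis by blast
qed

text \<open>A relation \<open>w * pderiv p = u * p\<close> with \<open>w \<noteq> 0\<close> forces \<open>w\<close> to vanish at every root of \<open>p\<close>,
  so linear independence of the family below means that \<open>p\<close> has at least \<open>k\<close> distinct roots.\<close>

definition root_family :: "nat \<Rightarrow> complex poly \<Rightarrow> nat \<Rightarrow> complex poly" where
  "root_family k p j = (if j < k then monom 1 j * pderiv p else monom 1 (j - k) * p)"

lemma sum_root_family:
  "(\<Sum>j<k + (k - 1). smult (a j) (root_family k p j)) =
    (\<Sum>j<k. monom (a j) j) * pderiv p + (\<Sum>j<k - 1. monom (a (k + j)) j) * p"
proof -
  have *: "(\<Sum>j<k + l. smult (a j) (root_family k p j)) =
    (\<Sum>j<k. smult (a j) (root_family k p j)) + (\<Sum>j<l. smult (a (k + j)) (root_family k p (k + j)))" for l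
    by (induction l) (auto simp: algebra_simps)
  show ?thesis unfolding *
    by (simp add: root_family_def sum_distrib_right smult_monom flip: mult_smult_left)
qed

text \<open>In \<open>w * pderiv p = - (u * p)\<close> the order of \<open>pderiv p\<close> at a
  root of \<open>p\<close> is one less than that of \<open>p\<close>, so \<open>w\<close> vanishes
  at all \<open>k\<close> roots; having degree below \<open>k\<close> it is zero, and then so is
  \<open>u\<close>.\<close>

lemma root_family_indep:
  assumes "p \<noteq> 0" "card {z. poly p z = 0} = k"
  shows "poly_indep (k + (k - 1)) (root_family k p)"
  unfolding poly_indep_def
proof (intro allI impI)
  fix a i assume 0: "(\<Sum>j<k + (k - 1). smult (a j) (root_family k p j)) = 0" and i: "i < k + (k - 1)"
  define w where "w = (\<Sum>j<k. monom (a j) j)"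
  define u where "u = (\<Sum>j<k - 1. monom (a (k + j)) j)"
  have cw: "coeff w j = (if j < k then a j else 0)" for j
    by (simp add: w_def coeff_sum)
  have cu: "coeff u j = (if j < k - 1 then a (k + j) else 0)" for j
    by (simp add: u_def coeff_sum)
  have wu: "w * pderiv p = - (u * p)"
    using 0 unfolding sum_root_family w_def[symmetric] u_def[symmetric]
    by (simp add: eq_neg_iff_add_eq_0)
  have "w = 0"
  proof (rule ccontr)
    assume w: "w \<noteq> 0"
    have "k \<noteq> 0"
    proof
      assume "k = 0"
      then have "w = 0" by (simp add: w_def)
      with w show False by simp
    qed
    have "poly w z = 0" if z: "poly p z = 0" for z
    proof -
      have ord: "order z p = Suc (order z (pderiv p))" by (rule order_pderiv[OF assms(1) z])
      have "pderiv p \<noteq> 0"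
      proof
        assume "pderiv p = 0"
        then obtain c where "p = [:c:]" by (auto simp: pderiv_eq_0_iff elim: degree_eq_zeroE)
        with z assms(1) show False by simp
      qed
      then have nz: "w * pderiv p \<noteq> 0" using w by simp
      have "p dvd w * pderiv p" unfolding wu by simp
      then have "order z p \<le> order z (w * pderiv p)" by (rule dvd_imp_order_le[OF nz])
      then have "order z w \<noteq> 0" using order_mult[OF nz, of z] ord by simp
      then show ?thesis by (simp add: order_root)
    qed
    then have "card {z. poly p z = 0} \<le> card {z. poly w z = 0}"
      by (intro card_mono poly_roots_finite w) auto
    also have "\<dots> \<le> degree w" by (rule card_poly_roots_bound[OF w])
    also have "degree w < k"
    proof -
      have "degree w \<le> k - 1" by (rule degree_le) (auto simp: cw)
      then show ?thesis using \<open>k \<noteq> 0\<close> by simp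
    qed
    finally show False using assms(2) by simp
  qed
  then have "u = 0" using wu assms(1) by auto
  show "a i = 0"
  proof (cases "i < k")
    case True
    then show ?thesis using cw[of i] \<open>w = 0\<close> by simp
  next
    case False
    then show ?thesis using cu[of "i - k"] \<open>u = 0\<close> i by (simp split: if_splits)
  qed
qed

text \<open>For \<open>w\<close> the product of the distinct linear factors, \<open>p\<close>
  divides \<open>w * pderiv p\<close>. The quotient has degree one less than \<open>w\<close>, so
  with fewer than \<open>k\<close> roots both fit into the family and give a nontrivial
  relation.\<close>

lemma root_family_dep:
  assumes "degree p > 0" "card {z. poly p z = 0} < k"
  shows "\<not> poly_indep (k + (k - 1)) (root_family k p)"
proof
  assume ind: "poly_indep (k + (k - 1)) (root_family k p)"
  have p: "p \<noteq> 0" "pderiv p \<noteq> 0" using assms(1) by (auto simp: pderiv_eq_0_iff)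
  define Z where "Z = {z. poly p z = 0}"
  have fin: "finite Z" unfolding Z_def by (rule poly_roots_finite[OF p(1)])
  define w where "w = (\<Prod>z\<in>Z. [:- z, 1:])"
  have w: "w \<noteq> 0" unfolding w_def using fin by auto
  have dw: "degree w = card Z" unfolding w_def by (subst degree_prod_sum_eq) auto
  have nz: "w * pderiv p \<noteq> 0" using w p by simp
  \<comment> \<open>Divisibility is checked on multiplicities: at every root of \<open>p\<close>,
    the factor \<open>w\<close> makes up for the one order lost by \<open>pderiv p\<close>.\<close>
  have "proots p \<subseteq># proots (w * pderiv p)"
  proof (rule mset_subset_eqI)
    fix z
    show "count (proots p) z \<le> count (proots (w * pderiv p)) z"
    proof (cases "z \<in> Z")
      case True
      have "poly w z = 0" unfolding w_def using True fin by (simp add: poly_prod)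
      then have "order z w \<ge> 1" using w by (simp add: order_root Suc_leI)
      then show ?thesis
        using order_pderiv[OF p(1), of z] True p nz by (simp add: order_mult Z_def)
    next
      case False
      then have "order z p = 0" by (simp add: Z_def order_0I)
      then show ?thesis using p by simp
    qed
  qed
  then have "(\<Prod>x\<in>#proots p. [:- x, 1:]) dvd (\<Prod>x\<in>#proots (w * pderiv p). [:- x, 1:])"
    by (intro prod_mset_subset_imp_dvd image_mset_subseteq_mono)
  then have "smult (lead_coeff p) (\<Prod>x\<in>#proots p. [:- x, 1:])
    dvd smult (lead_coeff (w * pderiv p)) (\<Prod>x\<in>#proots (w * pderiv p). [:- x, 1:])"
    using p(1) by (intro smult_dvd dvd_smult) auto
  then have "p dvd w * pderiv p"
    unfolding complex_poly_decompose_multiset .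
  then obtain u where u: "w * pderiv p = u * p" by (metis dvd_def mult.commute)
  have "u \<noteq> 0" using u nz by auto
  have "degree w + (degree p - 1) = degree u + degree p"
    using arg_cong[OF u, of degree] w p \<open>u \<noteq> 0\<close> by (simp add: degree_mult_eq degree_pderiv)
  then have du: "degree u < card Z" using assms(1) dw by linarith
  define a where "a j = (if j < k then coeff w j else - coeff u (j - k))" for j
  have "(\<Sum>j<n. monom (coeff r j) j) = r" if "degree r < n" for r :: "complex poly" and n
    by (rule poly_eqI) (use that in \<open>auto simp: coeff_sum coeff_eq_0\<close>)
  moreover have "(\<Sum>j<k. monom (a j) j) = (\<Sum>j<k. monom (coeff w j) j)"
    by (rule sum.cong) (auto simp: a_def)
  moreover have "(\<Sum>j<k - 1. monom (a (k + j)) j) = - (\<Sum>j<k - 1. monom (coeff u j) j)"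
    by (simp add: a_def sum_negf minus_monom[symmetric])
  ultimately have "(\<Sum>j<k + (k - 1). smult (a j) (root_family k p j)) = w * pderiv p - u * p"
    unfolding sum_root_family using dw du assms(2) by (simp add: Z_def)
  then have "a (card Z) = 0" using ind u assms(2) by (simp add: poly_indep_def Z_def)
  moreover have "a (card Z) = lead_coeff w" using assms(2) dw by (simp add: a_def Z_def)
  ultimately show False using w by simp
qed

text \<open>First the degree is maximized, then the number of distinct roots among the points of
  maximal degree. Independence of the root family at a maximizing point guarantees at least
  \<open>k\<close> roots wherever the pivots do not vanish, and maximality excludes more.\<close>

lemma generic_root_count:
  assumes P: "\<And>k. polyf I (\<lambda>x. coeff (P x) k)" and "\<And>x. degree (P x) \<le> D" and "P x1 \<noteq> 0"
  obtains Q x0 d k where "polyf I Q" "Q x0 \<noteq> 0" "d \<le> D"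
    "\<And>x. Q x \<noteq> 0 \<Longrightarrow> P x \<noteq> 0 \<and> degree (P x) = d \<and> card {z. poly (P x) z = 0} = k"
proof -
  obtain x2 where x2: "P x2 \<noteq> 0" "\<And>x. P x \<noteq> 0 \<Longrightarrow> degree (P x) \<le> degree (P x2)"
    using ex_has_greatest_nat[of "\<lambda>x. P x \<noteq> 0" x1 "\<lambda>x. degree (P x)" "Suc D"] assms by (auto simp: less_Suc_eq_le)
  define d where "d = degree (P x2)"
  have deg: "P x \<noteq> 0 \<and> degree (P x) = d" if "coeff (P x) d \<noteq> 0" for x
    using that x2(2)[of x] le_degree[of "P x" d] unfolding d_def by force
  have cardle: "card {z. poly (P x) z = 0} \<le> d" if "coeff (P x) d \<noteq> 0" for x
    using card_poly_roots_bound[of "P x"] deg[OF that] by simp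
  have "coeff (P x2) d \<noteq> 0" using x2 by (simp add: d_def)
  then obtain x0 where x0: "coeff (P x0) d \<noteq> 0"
    "\<And>x. coeff (P x) d \<noteq> 0 \<Longrightarrow> card {z. poly (P x) z = 0} \<le> card {z. poly (P x0) z = 0}"
    using ex_has_greatest_nat[of "\<lambda>x. coeff (P x) d \<noteq> 0" x2 "\<lambda>x. card {z. poly (P x) z = 0}" "Suc d"] cardle
    by (auto simp: less_Suc_eq_le)
  define k where "k = card {z. poly (P x0) z = 0}"
  have "polyf I (\<lambda>x. coeff (root_family k (P x) j) l)" for j l
    unfolding root_family_def
    by (cases "j < k") (auto simp: coeff_monom_mult coeff_pderiv intro!: polyf_if polyf_mult polyf_add P polyf_const)
  moreover have "poly_indep (k + (k - 1)) (root_family k (P x0))"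
    by (rule root_family_indep) (use deg x0 k_def in auto)
  ultimately obtain Q where Q: "polyf I Q" "Q x0 \<noteq> 0"
    "\<And>x. Q x \<noteq> 0 \<Longrightarrow> poly_indep (k + (k - 1)) (root_family k (P x))"
    using poly_indep_generic[of I "\<lambda>j x. root_family k (P x) j" "k + (k - 1)" x0] by blast
  have "card {z. poly (P x) z = 0} = k" if "Q x * coeff (P x) d \<noteq> 0" for x
  proof -
    have x: "Q x \<noteq> 0" "coeff (P x) d \<noteq> 0" using that by auto
    have "k \<le> card {z. poly (P x) z = 0}"
    proof (cases "d = 0")
      case True
      then show ?thesis using cardle[OF x0(1)] by (simp add: k_def)
    next
      case False
      then have "degree (P x) > 0" using deg[OF x(2)] by simp
      then show ?thesis
        using root_family_dep[of "P x" k] Q(3)[OF x(1)] linorder_not_less by blast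
    qed
    with x0(2)[OF x(2)] show ?thesis by (simp add: k_def)
  qed
  moreover have "polyf I (\<lambda>x. Q x * coeff (P x) d)" by (intro polyf_mult Q P)
  moreover have "d \<le> D" using assms(2) by (simp add: d_def)
  ultimately show ?thesis
    using that[of "\<lambda>x. Q x * coeff (P x) d" x0 d k] Q(2) x0(1) deg by auto
qed

section \<open>Bands between consecutive real roots\<close>

lemma exists_gap_with_count:
  fixes A :: "real set"
  assumes "finite A" "j \<le> card A"
  obtains t where "t \<notin> A" "card {s \<in> A. s < t} = j"
proof -
  \<comment> \<open>The bound \<open>u\<close> strengthens the induction: \<open>t\<close> can be
    kept below the next larger element of the set, which is then not counted.\<close>
  have "\<exists>t<u. t \<notin> A \<and> card {s \<in> A. s < t} = j" if "\<And>a. a \<in> A \<Longrightarrow> a < u" for u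
    using assms that
  proof (induction A arbitrary: j u rule: finite_linorder_max_induct)
    case empty
    then show ?case by (auto intro: exI[of _ "u - 1"])
  next
    case (insert b A)
    show ?case
    proof (cases "j \<le> card A")
      case True
      obtain t where t: "t < b" "t \<notin> A" "card {s \<in> A. s < t} = j"
        using insert.IH[of j b] True insert.hyps by blast
      have "{s \<in> insert b A. s < t} = {s \<in> A. s < t}" using t by auto
      moreover have "b < u" using insert.prems by simp
      ultimately show ?thesis using t by (intro exI[of _ t]) auto
    next
      case False
      then have j: "j = Suc (card A)" "b \<notin> A" using insert by (auto simp: card_insert_if split: if_splits)
      have "b < u" using insert.prems by simp
      then obtain t where t: "b < t" "t < u" using dense by blast
      then have lt: "s < t" if "s \<in> insert b A" for s using that insert.hyps by auto
      then have "{s \<in> insert b A. s < t} = insert b A" by blast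
      moreover have "t \<notin> insert b A" using lt[of t] by blast
      ultimately show ?thesis using t j insert.hyps by (intro exI[of _ t]) simp
    qed
  qed
  moreover have "\<And>a. a \<in> A \<Longrightarrow> a < Max A + 1"
    using Max_ge[OF assms(1)] by (auto intro: le_less_trans[OF _ less_add_one])
  ultimately show ?thesis using that by blast
qed

text \<open>The part of the cylinder over \<open>S\<close> lying strictly between the \<open>j\<close>-th and the \<open>(j + 1)\<close>-st
  real root of \<open>P\<close> in the direction of the \<open>i\<close>-th coordinate.\<close>

definition band :: "'n \<Rightarrow> (real ^ 'n \<Rightarrow> complex poly) \<Rightarrow> (real ^ 'n) set \<Rightarrow> nat \<Rightarrow> (real ^ 'n) set" where
  "band i P S j = {x \<in> S. poly (P x) (of_real (x $ i)) \<noteq> 0 \<and>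
     card {s \<in> {..<x $ i}. poly (P x) (of_real s) = 0} = j}"

lemma eventually_card_real_roots:
  fixes P :: "real ^ 'n::finite \<Rightarrow> complex poly"
  assumes P: "\<And>k. polyf I (\<lambda>x. coeff (P x) k)"
    and S: "\<And>x. x \<in> S \<Longrightarrow> P x \<noteq> 0 \<and> degree (P x) = d \<and> card {z. poly (P x) z = 0} = k"
    and cnj: "\<And>x z. poly (P x) z = 0 \<Longrightarrow> poly (P x) (cnj z) = 0"
    and x0: "x0 \<in> S" and U: "\<And>t. t \<in> frontier U \<Longrightarrow> poly (P x0) (of_real t) \<noteq> 0"
  shows "\<forall>\<^sub>F x in at x0 within S. card {s \<in> U. poly (P x) (of_real s) = 0}
    = card {s \<in> U. poly (P x0) (of_real s) = 0}"
proof -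
  \<comment> \<open>\<open>card_real_roots_locally_constant\<close> asks for its hypotheses at all
    points, so the family is made constant outside \<open>S\<close>; the filter sees only points of
    \<open>S\<close>.\<close>
  define p where "p x = (if x \<in> S then P x else P x0)" for x
  have inS: "\<forall>\<^sub>F x in at x0 within S. x \<in> S" by (simp add: eventually_at_filter)
  have lim: "((\<lambda>x. coeff (p x) l) \<longlongrightarrow> coeff (P x0) l) (at x0 within S)" for l
  proof (rule Lim_transform_eventually)
    show "((\<lambda>x. coeff (P x) l) \<longlongrightarrow> coeff (P x0) l) (at x0 within S)"
      using continuous_on_polyf[OF P, of S l] x0 by (simp add: continuous_on_def)
    show "\<forall>\<^sub>F x in at x0 within S. coeff (P x) l = coeff (p x) l"
      using inS by eventually_elim (simp add: p_def)
  qed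
  have "\<forall>\<^sub>F x in at x0 within S. card {s \<in> U. poly (p x) (of_real s) = 0}
    = card {s \<in> U. poly (P x0) (of_real s) = 0}"
    by (rule card_real_roots_locally_constant[of p d "P x0"])
      (use S x0 U lim cnj in \<open>auto simp: p_def split: if_splits\<close>)
  with inS show ?thesis by eventually_elim (simp add: p_def)
qed

text \<open>Equal counts leave no element of \<open>R\<close> in the half-open interval from
  \<open>a\<close> to \<open>b\<close>; the last hypothesis handles \<open>t = b\<close>. This makes
  the fibres of a band intervals.\<close>

lemma card_interval_between:
  fixes R :: "real set"
  assumes "finite R" "card {s \<in> {..<a}. s \<in> R} = card {s \<in> {..<b}. s \<in> R}" "a \<le> t" "t \<le> b" "t \<notin> R \<or> t < b"
  shows "t \<notin> R \<and> card {s \<in> {..<t}. s \<in> R} = card {s \<in> {..<b}. s \<in> R}"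
proof -
  have fin: "finite {s \<in> {..<b}. s \<in> R}" using assms(1) by simp
  have eq: "{s \<in> {..<a}. s \<in> R} = {s \<in> {..<b}. s \<in> R}"
    using assms by (intro card_subset_eq[OF fin]) auto
  have "t \<notin> R"
  proof
    assume "t \<in> R"
    with assms(5) have "t \<in> {s \<in> {..<b}. s \<in> R}" by simp
    then have "t < a" unfolding eq[symmetric] by simp
    with assms(3) show False by simp
  qed
  moreover have "{s \<in> {..<t}. s \<in> R} = {s \<in> {..<b}. s \<in> R}"
  proof
    show "{s \<in> {..<b}. s \<in> R} \<subseteq> {s \<in> {..<t}. s \<in> R}"
      unfolding eq[symmetric] using assms(3) by auto
  qed (use assms(4) in auto)
  ultimately show ?thesis by simp
qed

text \<open>The map \<pi> forgets coordinate \<open>i\<close> by setting it to zero. On a nonempty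
  band its image is that of all of \<open>S\<close>, hence connected; it is open onto this image and
  has interval fibres, and for such maps connectedness passes to the preimage.\<close>

lemma connected_band:
  fixes P :: "real ^ 'n::finite \<Rightarrow> complex poly"
  assumes P: "\<And>k. polyf I (\<lambda>x. coeff (P x) k)"
    and S: "\<And>x. x \<in> S \<Longrightarrow> P x \<noteq> 0 \<and> degree (P x) = d \<and> card {z. poly (P x) z = 0} = k"
    and cnj: "\<And>x z. poly (P x) z = 0 \<Longrightarrow> poly (P x) (cnj z) = 0"
    and conn: "connected S" and i: "i \<notin> I"
    and cyl: "\<And>x y. x \<in> S \<Longrightarrow> (\<And>l. l \<in> I \<Longrightarrow> x $ l = y $ l) \<Longrightarrow> y \<in> S"
  shows "connected (band i P S j)"
proof -
  define \<pi> :: "real ^ 'n \<Rightarrow> real ^ 'n" where "\<pi> x = (\<chi> l. if l = i then 0 else x $ l)" for x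
  have pi_nth: "\<pi> x $ l = (if l = i then 0 else x $ l)" for x l by (simp add: \<pi>_def)
  have P_cong: "P x = P y" if "\<And>l. l \<in> I \<Longrightarrow> x $ l = y $ l" for x y
    by (rule poly_eqI) (rule polyf_cong[OF P that])
  have P_pi: "P (\<pi> x) = P x" for x by (rule P_cong) (use i in \<open>auto simp: pi_nth\<close>)
  have S_cong: "x \<in> S \<longleftrightarrow> y \<in> S" if "\<And>l. l \<in> I \<Longrightarrow> x $ l = y $ l" for x y
    using cyl[of x y] cyl[of y x] that by fastforce
  have S_pi: "\<pi> x \<in> S \<longleftrightarrow> x \<in> S" for x by (rule S_cong) (use i in \<open>auto simp: pi_nth\<close>)
  define L where "L t y = y + axis i t" for t :: real and y :: "real ^ 'n"
  have L_nth: "L t y $ l = (if l = i then y $ l + t else y $ l)" for t y l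
    by (auto simp: L_def axis_def)
  have P_L: "P (L t y) = P y" for t y by (rule P_cong) (use i in \<open>auto simp: L_nth\<close>)
  have S_L: "L t y \<in> S \<longleftrightarrow> y \<in> S" for t y
    by (rule S_cong) (use i in \<open>auto simp: L_nth\<close>)
  have pi_L: "\<pi> (L t y) = \<pi> y" for t y by (simp add: vec_eq_iff pi_nth L_nth)
  have L_pi: "L (x $ i) (\<pi> x) = x" for x by (auto simp: vec_eq_iff pi_nth L_nth)
  have pi_id: "\<pi> y = y" if "y $ i = 0" for y using that by (simp add: vec_eq_iff pi_nth)
  have lin: "linear \<pi>" by (rule linearI) (auto simp: vec_eq_iff pi_nth)
  then have cont_pi: "continuous_on A \<pi>" for A
    using linear_continuous_on linear_conv_bounded_linear by blast
  let ?B = "band i P S j"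
  define R where "R x = {s::real. poly (P x) (of_real s) = 0}" for x
  have R_pi: "R (\<pi> x) = R x" and R_L: "R (L t x) = R x" for x t by (simp_all add: R_def P_pi P_L)
  have finR: "finite (R x)" if "x \<in> S" for x
  proof -
    have "finite (complex_of_real -` {z. poly (P x) z = 0})"
      by (intro finite_vimageI poly_roots_finite) (use S[OF that] in \<open>auto simp: inj_on_def\<close>)
    then show ?thesis by (simp add: R_def vimage_def)
  qed
  have B_iff: "x \<in> ?B \<longleftrightarrow> x \<in> S \<and> x $ i \<notin> R x \<and> card {s \<in> {..<x $ i}. s \<in> R x} = j" for x
    by (simp add: band_def R_def)
  have R_const: "card (R x) = card (R y)" if "x \<in> S" "y \<in> S" for x y
  proof (rule connected_local_const[OF conn that])
    show "\<forall>x\<in>S. \<forall>\<^sub>F y in at x within S. card (R x) = card (R y)"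
    proof
      fix x assume "x \<in> S"
      then have "\<forall>\<^sub>F y in at x within S. card {s \<in> UNIV. poly (P y) (of_real s) = 0}
        = card {s \<in> UNIV. poly (P x) (of_real s) = 0}"
        by (intro eventually_card_real_roots[OF P S cnj]) simp_all
      then show "\<forall>\<^sub>F y in at x within S. card (R x) = card (R y)"
        by (rule eventually_mono) (simp add: R_def)
    qed
  qed
  \<comment> \<open>A point of the band shows that at least \<open>j\<close> real roots lie over its
    base point. The number of real roots is constant on \<open>S\<close>, so every base point has a
    gap with exactly \<open>j\<close> roots below it.\<close>
  have pi_B: "\<pi> ` ?B = \<pi> ` S" if "?B \<noteq> {}"
  proof (intro equalityI subsetI)
    fix y assume "y \<in> \<pi> ` S"
    then obtain x where x: "x \<in> S" "y = \<pi> x" by blast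
    obtain b where b: "b \<in> ?B" using \<open>?B \<noteq> {}\<close> by blast
    have "j \<le> card (R b)"
      using b finR[of b] unfolding B_iff by (auto intro!: card_mono)
    then have "j \<le> card (R x)" using R_const[of b x] b x by (simp add: B_iff)
    then obtain t where t: "t \<notin> R x" "card {s \<in> R x. s < t} = j"
      using exists_gap_with_count[OF finR[OF x(1)]] by blast
    have "{s \<in> {..<t}. s \<in> R x} = {s \<in> R x. s < t}" by auto
    then have "L t y \<in> ?B" using x t by (simp add: B_iff S_L S_pi R_L R_pi L_nth pi_nth)
    moreover have "\<pi> (L t y) = y" using x by (simp add: pi_L pi_id pi_nth)
    ultimately show "y \<in> \<pi> ` ?B" by (metis imageI)
  qed (auto simp: B_iff)
  \<comment> \<open>The height \<open>t\<close> of a point of \<open>C\<close> is kept while the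
    base point varies: nearby, \<open>t\<close> stays a non-root and the number of roots below it
    stays \<open>j\<close>, by local constancy with \<open>U = {..<t}\<close>.\<close>
  have open_map: "openin (top_of_set (\<pi> ` ?B)) (\<pi> ` C)" if C: "openin (top_of_set ?B) C" for C
  proof (subst openin_subopen, intro ballI)
    fix y assume "y \<in> \<pi> ` C"
    then obtain x where x: "x \<in> C" "y = \<pi> x" by blast
    obtain O' where O': "open O'" "C = ?B \<inter> O'" using C by (meson openin_open)
    define t where "t = x $ i"
    have xB: "x \<in> ?B" and yS: "y \<in> S" using x O' by (auto simp: B_iff S_pi)
    have Ly: "L t y = x" by (simp add: x t_def L_pi)
    have tR: "poly (P y) (of_real t) \<noteq> 0" using xB by (simp add: B_iff R_def x P_pi t_def)
    have lim: "((\<lambda>z. poly (P z) (of_real t)) \<longlongrightarrow> poly (P y) (of_real t)) (at y within S)"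
    proof -
      have inS: "\<forall>\<^sub>F z in at y within S. z \<in> S" by (simp add: eventually_at_filter)
      have a: "((\<lambda>z. \<Sum>l\<le>d. coeff (P z) l * of_real t ^ l)
        \<longlongrightarrow> (\<Sum>l\<le>d. coeff (P y) l * of_real t ^ l)) (at y within S)"
        using continuous_on_polyf[OF P, of S] yS
        by (intro tendsto_intros) (auto simp: continuous_on_def)
      have b: "\<forall>\<^sub>F z in at y within S.
        (\<Sum>l\<le>d. coeff (P z) l * of_real t ^ l) = poly (P z) (of_real t)"
        using inS by eventually_elim (use S in \<open>auto simp: poly_altdef\<close>)
      have c: "(\<Sum>l\<le>d. coeff (P y) l * of_real t ^ l) = poly (P y) (of_real t)"
        using S[OF yS] by (auto simp: poly_altdef)
      show ?thesis using Lim_transform_eventually[OF a b] unfolding c .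
    qed
    have "\<forall>\<^sub>F z in at y within S. card {s \<in> {..<t}. poly (P z) (of_real s) = 0}
      = card {s \<in> {..<t}. poly (P y) (of_real s) = 0}"
      by (rule eventually_card_real_roots[OF P S cnj yS]) (use tR in auto)
    moreover have "\<forall>\<^sub>F z in at y within S. poly (P z) (of_real t) \<noteq> 0"
      by (rule tendsto_imp_eventually_ne[OF lim tR])
    moreover have "\<forall>\<^sub>F z in at y within S. L t z \<in> O'"
    proof (rule topological_tendstoD[OF _ O'(1)])
      show "(L t \<longlongrightarrow> x) (at y within S)" unfolding Ly[symmetric] L_def by (intro tendsto_intros)
      show "x \<in> O'" using x O' by simp
    qed
    ultimately have "\<forall>\<^sub>F z in at y within S. z $ i = 0 \<longrightarrow> z \<in> S \<longrightarrow> L t z \<in> C"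
    proof eventually_elim
      case (elim z)
      have "card {s \<in> {..<t}. poly (P y) (of_real s) = 0} = j"
        using xB by (simp add: B_iff R_def x P_pi t_def)
      then show ?case using elim by (simp add: O' B_iff S_L P_L L_nth R_def)
    qed
    then obtain W where W: "open W" "y \<in> W"
      "\<And>z. z \<in> W \<Longrightarrow> z \<noteq> y \<Longrightarrow> z \<in> S \<Longrightarrow> z $ i = 0 \<Longrightarrow> L t z \<in> C"
      unfolding eventually_at_topological by blast
    show "\<exists>T. openin (top_of_set (\<pi> ` ?B)) T \<and> y \<in> T \<and> T \<subseteq> \<pi> ` C"
    proof (intro exI conjI subsetI)
      show "openin (top_of_set (\<pi> ` ?B)) (\<pi> ` ?B \<inter> W)" by (simp add: W openin_open_Int)
      show "y \<in> \<pi> ` ?B \<inter> W" using W x O' by auto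
      fix z assume z: "z \<in> \<pi> ` ?B \<inter> W"
      then have "z \<in> S" "z $ i = 0" by (auto simp: B_iff S_pi pi_nth)
      then have "L t z \<in> C" using W(3)[of z] z Ly x by (cases "z = y") auto
      moreover have "\<pi> (L t z) = z" using \<open>z $ i = 0\<close> by (simp add: pi_L pi_id)
      ultimately show "z \<in> \<pi> ` C" by (metis imageI)
    qed
  qed
  have fiber: "connected (?B \<inter> \<pi> -` {y})" if y: "y \<in> \<pi> ` ?B" for y
  proof -
    have yS: "y \<in> S" and yi: "y $ i = 0" using y by (auto simp: B_iff S_pi pi_nth)
    define J where "J = {t. t \<notin> R y \<and> card {s \<in> {..<t}. s \<in> R y} = j}"
    have "?B \<inter> \<pi> -` {y} = (\<lambda>t. L t y) ` J"
    proof (intro equalityI subsetI)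
      fix x assume "x \<in> ?B \<inter> \<pi> -` {y}"
      then have x: "x \<in> ?B" "y = \<pi> x" by auto
      then have "x $ i \<in> J" by (simp add: J_def B_iff R_pi)
      moreover have "x = L (x $ i) y" by (simp add: x L_pi)
      ultimately show "x \<in> (\<lambda>t. L t y) ` J" by (metis imageI)
    next
      fix x assume "x \<in> (\<lambda>t. L t y) ` J"
      then show "x \<in> ?B \<inter> \<pi> -` {y}"
        using yS yi by (auto simp: J_def B_iff S_L R_L L_nth pi_L pi_id)
    qed
    moreover have "is_interval J"
      unfolding is_interval_1
    proof (intro ballI allI impI)
      fix a b t assume ab: "a \<in> J" "b \<in> J" "a \<le> t \<and> t \<le> b"
      show "t \<in> J"
        using card_interval_between[OF finR[OF yS], of a b t] ab
        by (cases "t = b") (auto simp: J_def)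
    qed
    moreover have "continuous_on J (\<lambda>t. L t y)"
    proof -
      have *: "(\<lambda>t. L t y) = (\<lambda>t. y + t *\<^sub>R axis i 1)"
        by (auto simp: L_def axis_def vec_eq_iff)
      show ?thesis unfolding * by (intro continuous_intros)
    qed
    ultimately show ?thesis using connected_continuous_image[of J "\<lambda>t. L t y"] by (simp add: is_interval_connected_1)
  qed
  have "connected (\<pi> ` ?B)"
  proof (cases "?B = {}")
    case False
    then show ?thesis using pi_B connected_continuous_image[OF cont_pi conn] by simp
  qed simp
  have "connected (?B \<inter> \<pi> -` (\<pi> ` ?B))"
  proof (rule connected_open_monotone_preimage[of ?B \<pi> "\<pi> ` ?B" "\<pi> ` ?B"])
    show "openin (top_of_set (\<pi> ` ?B)) (\<pi> ` C)" if "openin (top_of_set ?B) C" for C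
      using that by (rule open_map)
    show "connected (?B \<inter> \<pi> -` {y})" if "y \<in> \<pi> ` ?B" for y
      using that by (rule fiber)
  qed (use \<open>connected (\<pi> ` ?B)\<close> cont_pi in blast)+
  moreover have "?B \<inter> \<pi> -` (\<pi> ` ?B) = ?B" by auto
  ultimately show ?thesis by simp
qed

section \<open>Decomposition into connected cells\<close>

text \<open>Induction on the variables: the new cells are the bands over the cells of a generic
  \<open>Q\<close> in the variables \<open>I\<close>. Only density of the union is claimed, so the
  zero sets of \<open>Q\<close> and \<open>p\<close> may be dropped; the cylinder property lets
  coordinate \<open>i\<close> move freely inside a cell of \<open>Q\<close>.\<close>

lemma polyf_cells:
  fixes p :: "real ^ 'n::finite \<Rightarrow> complex"
  assumes "finite I" "polyf I p" "p x0 \<noteq> 0"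
  shows "\<exists>\<S>. finite \<S> \<and> closure (\<Union>\<S>) = UNIV \<and>
    (\<forall>S\<in>\<S>. connected S \<and> (\<forall>x\<in>S. p x \<noteq> 0) \<and>
      (\<forall>x y. x \<in> S \<longrightarrow> (\<forall>l\<in>I. x $ l = y $ l) \<longrightarrow> y \<in> S))"
  using assms
proof (induction I arbitrary: p x0 rule: finite_induct)
  case empty
  have "p x \<noteq> 0" for x using polyf_cong[OF empty(1), of x x0] empty(2) by simp
  then show ?case by (intro exI[of _ "{UNIV}"]) (simp add: convex_connected)
next
  case (insert i I)
  obtain A D where A: "\<And>k. polyf I (\<lambda>x. coeff (A x) k)" "\<And>x. degree (A x) \<le> D"
    "\<And>x. p x = poly (A x) (of_real (x $ i))"
    using polyf_insert_expand[OF insert.prems(1)] by blast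
  \<comment> \<open>The factor with conjugated coefficients makes the root set closed under
    conjugation, and at real arguments \<open>P x\<close> vanishes exactly where \<open>A x\<close>
    does.\<close>
  define P where "P x = A x * map_poly cnj (A x)" for x
  have polyf_P: "polyf I (\<lambda>x. coeff (P x) k)" for k
    unfolding P_def by (intro polyf_coeff_mult A) (simp add: coeff_map_poly polyf_cnj A)
  have poly_P: "poly (P x) z = poly (A x) z * cnj (poly (A x) (cnj z))" for x z
    unfolding P_def poly_mult using poly_cnj[of "A x" "cnj z"] by simp
  have cnj: "poly (P x) (cnj z) = 0" if "poly (P x) z = 0" for x z
    using that by (auto simp: poly_P)
  have P_0_iff: "poly (P x) (of_real (x $ i)) = 0 \<longleftrightarrow> p x = 0" for x
    by (simp add: poly_P A(3))
  have deg_P: "degree (P x) \<le> D + D" for x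
    using degree_mult_le[of "A x" "map_poly cnj (A x)"] A(2)[of x] by (simp add: P_def degree_map_poly)
  have P_ne: "P x0 \<noteq> 0" using P_0_iff[of x0] insert.prems(2) by auto
  obtain Q y0 d k where Q: "polyf I Q" "Q y0 \<noteq> 0" "d \<le> D + D"
    "\<And>x. Q x \<noteq> 0 \<Longrightarrow> P x \<noteq> 0 \<and> degree (P x) = d \<and> card {z. poly (P x) z = 0} = k"
    by (rule generic_root_count[of I P "D + D" x0, OF polyf_P deg_P P_ne]) (rule that)
  obtain \<S> where S0: "finite \<S> \<and> closure (\<Union>\<S>) = UNIV \<and>
    (\<forall>S\<in>\<S>. connected S \<and> (\<forall>x\<in>S. Q x \<noteq> 0) \<and>
      (\<forall>x y. x \<in> S \<longrightarrow> (\<forall>l\<in>I. x $ l = y $ l) \<longrightarrow> y \<in> S))"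
    using insert.IH[OF Q(1,2)] ..
  have fin_S: "finite \<S>" and dense_S: "closure (\<Union>\<S>) = UNIV"
    using S0 by simp_all
  have S: "connected T" "x \<in> T \<Longrightarrow> Q x \<noteq> 0"
    "x \<in> T \<Longrightarrow> (\<And>l. l \<in> I \<Longrightarrow> x $ l = y $ l) \<Longrightarrow> y \<in> T" if "T \<in> \<S>" for T x y
    using S0 that by simp_all
  define \<T> where "\<T> = (\<lambda>(S, j). band i P S j) ` (\<S> \<times> {..k})"
  have cover: "x \<in> \<Union>\<T>" if x: "x \<in> S" "S \<in> \<S>" "p x \<noteq> 0" for x S
  proof -
    have Px: "P x \<noteq> 0" "card {z. poly (P x) z = 0} = k" using Q(4) S(2) x by blast+
    have "card {s \<in> {..<x $ i}. poly (P x) (of_real s) = 0} \<le> card {z. poly (P x) z = 0}"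
      by (rule card_inj_on_le[of complex_of_real]) (auto simp: inj_on_def poly_roots_finite Px)
    then have "x \<in> band i P S (card {s \<in> {..<x $ i}. poly (P x) (of_real s) = 0})"
      "card {s \<in> {..<x $ i}. poly (P x) (of_real s) = 0} \<in> {..k}"
      using x Px P_0_iff[of x] by (auto simp: band_def)
    then show ?thesis unfolding \<T>_def using x(2) by blast
  qed
  show ?case
  proof (intro exI[of _ \<T>] conjI ballI)
    show "finite \<T>" by (simp add: \<T>_def fin_S)
    show "closure (\<Union>\<T>) = UNIV"
    proof (intro equalityI subsetI UNIV_I)
      fix x :: "real ^ 'n"
      show "x \<in> closure (\<Union>\<T>)"
        unfolding closure_approachable
      proof (intro allI impI)
        fix e :: real assume e: "e > 0"
        have "x \<in> closure (\<Union>\<S>)" using dense_S by simp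
        \<comment> \<open>A cell of \<open>Q\<close> is reached within \<open>e / 2\<close>; a
          further move along coordinate \<open>i\<close> by less than \<open>e / 2\<close> stays in
          the cylinder and avoids the finitely many real roots.\<close>
        then obtain y S where y: "y \<in> S" "S \<in> \<S>" "dist y x < e / 2"
          unfolding closure_approachable using e by (metis UnionE half_gt_zero)
        have Py: "P y \<noteq> 0" using Q(4) S(2) y by blast
        have "finite (complex_of_real -` {z. poly (P y) z = 0})"
          by (intro finite_vimageI poly_roots_finite Py) (auto simp: inj_on_def)
        moreover have "infinite {y $ i<..<y $ i + e / 2}" using e by simp
        ultimately obtain t where t: "y $ i < t" "t < y $ i + e / 2" "poly (P y) (of_real t) \<noteq> 0"
        proof -
          assume fin: "finite (complex_of_real -` {z. poly (P y) z = 0})"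
            and inf: "infinite {y $ i<..<y $ i + e / 2}"
          then have "\<not> {y $ i<..<y $ i + e / 2} \<subseteq> complex_of_real -` {z. poly (P y) z = 0}"
            using finite_subset by blast
          then obtain t where "t \<in> {y $ i<..<y $ i + e / 2}"
            "t \<notin> complex_of_real -` {z. poly (P y) z = 0}" by blast
          then show thesis using that[of t] by simp
        qed
        define y' where "y' = y + axis i (t - y $ i)"
        have y'_nth: "y' $ l = (if l = i then t else y $ l)" for l
          by (auto simp: y'_def axis_def)
        have y'S: "y' \<in> S" by (rule S(3)[OF y(2,1)]) (use insert.hyps in \<open>auto simp: y'_nth\<close>)
        have "P y' = P y"
          by (rule poly_eqI, rule polyf_cong[OF polyf_P]) (use insert.hyps in \<open>auto simp: y'_nth\<close>)
        then have "p y' \<noteq> 0" using t P_0_iff[of y'] by (simp add: y'_nth)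
        then have "y' \<in> \<Union>\<T>" using cover y'S y by blast
        have dist_y': "dist y' y < e / 2"
        proof -
          have "axis i (t - y $ i) = (t - y $ i) *\<^sub>R axis i (1::real)"
            by (simp add: axis_def vec_eq_iff)
          then show ?thesis using t by (simp add: y'_def dist_norm norm_axis_1)
        qed
        have "dist y' x < e"
          by (rule dist_triangle_half_r[of y]) (use y(3) dist_y' in \<open>simp_all add: dist_commute\<close>)
        with \<open>y' \<in> \<Union>\<T>\<close> show "\<exists>y\<in>\<Union>\<T>. dist y x < e" by blast
      qed
    qed
  next
    fix T assume "T \<in> \<T>"
    then obtain S j where T: "S \<in> \<S>" "T = band i P S j" by (auto simp: \<T>_def)
    show "connected T" unfolding T
      by (rule connected_band[OF polyf_P Q(4)[OF S(2)[OF T(1)]] cnj S(1)[OF T(1)]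
            insert.hyps(2) S(3)[OF T(1)]])
    show "p x \<noteq> 0" if "x \<in> T" for x using that P_0_iff[of x] by (simp add: T band_def)
    show "\<forall>x y. x \<in> T \<longrightarrow> (\<forall>l\<in>insert i I. x $ l = y $ l) \<longrightarrow> y \<in> T"
    proof (intro allI impI)
      fix x y assume x: "x \<in> T" and eq: "\<forall>l\<in>insert i I. x $ l = y $ l"
      have "P x = P y" by (rule poly_eqI, rule polyf_cong[OF polyf_P]) (use eq in auto)
      moreover have "y \<in> S" by (rule S(3)[OF T(1), of x]) (use x eq T in \<open>auto simp: band_def\<close>)
      ultimately show "y \<in> T" using x eq by (simp add: T band_def)
    qed
  qed
qed

section \<open>Restriction of a polynomial to lines with real direction\<close>

definition line_poly :: "'n::finite cpoly \<Rightarrow> complex ^ 'n \<Rightarrow> real ^ 'n \<Rightarrow> complex poly" where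
  "line_poly f z v = (\<Sum>m\<in>Poly_Mapping.keys f.
     smult (Poly_Mapping.lookup f m) (\<Prod>i\<in>UNIV. [:z $ i, of_real (v $ i):] ^ Poly_Mapping.lookup m i))"

definition total_deg :: "'n::finite cpoly \<Rightarrow> nat" where
  "total_deg f = Max ((\<lambda>m. \<Sum>i\<in>UNIV. Poly_Mapping.lookup m i) ` Poly_Mapping.keys f)"

definition lead_form :: "'n::finite cpoly \<Rightarrow> real ^ 'n \<Rightarrow> complex" where
  "lead_form f v = (\<Sum>m\<in>Poly_Mapping.keys f.
     if (\<Sum>i\<in>UNIV. Poly_Mapping.lookup m i) = total_deg f
     then Poly_Mapping.lookup f m * (\<Prod>i\<in>UNIV. of_real (v $ i) ^ Poly_Mapping.lookup m i) else 0)"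

lemma poly_line_poly:
  "poly (line_poly f z v) t = eval_cpoly f (\<chi> i. z $ i + t * of_real (v $ i))"
  by (simp add: line_poly_def eval_cpoly_def poly_sum poly_prod)

lemma coeff_mult_degree_bounds:
  assumes "degree p \<le> a" "degree q \<le> b"
  shows "coeff (p * q) (a + b) = coeff p a * coeff q b"
proof (cases "degree p = a \<and> degree q = b")
  case True
  then show ?thesis using coeff_mult_degree_sum by blast
next
  case False
  then have "degree (p * q) < a + b" "degree p < a \<or> degree q < b"
    using assms degree_mult_le[of p q] by auto
  then show ?thesis by (auto simp: coeff_eq_0)
qed

lemma degree_coeff_linear_power:
  fixes a b :: "'a::comm_ring_1"
  shows "degree ([:a, b:] ^ n) \<le> n \<and> coeff ([:a, b:] ^ n) n = b ^ n"
proof (induction n)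
  case (Suc n)
  have lin: "degree [:a, b:] \<le> 1" by simp
  have "degree ([:a, b:] ^ Suc n) \<le> 1 + n"
    using degree_mult_le[of "[:a, b:]" "[:a, b:] ^ n"] lin Suc unfolding power_Suc by linarith
  moreover have "coeff ([:a, b:] ^ Suc n) (1 + n) = b ^ Suc n"
    unfolding power_Suc using coeff_mult_degree_bounds[OF lin conjunct1[OF Suc]] Suc by simp
  ultimately show ?case by simp
qed simp

lemma degree_coeff_linear_prod:
  fixes a b :: "'i \<Rightarrow> 'a::comm_ring_1"
  assumes "finite A"
  shows "degree (\<Prod>i\<in>A. [:a i, b i:] ^ m i) \<le> (\<Sum>i\<in>A. m i) \<and>
    coeff (\<Prod>i\<in>A. [:a i, b i:] ^ m i) (\<Sum>i\<in>A. m i) = (\<Prod>i\<in>A. b i ^ m i)"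
  using assms
proof (induction A rule: finite_induct)
  case (insert i A)
  define p where "p = [:a i, b i:] ^ m i"
  define q where "q = (\<Prod>i\<in>A. [:a i, b i:] ^ m i)"
  have p: "degree p \<le> m i" "coeff p (m i) = b i ^ m i"
    using degree_coeff_linear_power by (auto simp: p_def)
  have q: "degree q \<le> (\<Sum>i\<in>A. m i)" "coeff q (\<Sum>i\<in>A. m i) = (\<Prod>i\<in>A. b i ^ m i)"
    using insert.IH by (auto simp: q_def)
  have "degree (p * q) \<le> m i + (\<Sum>i\<in>A. m i)"
    using degree_mult_le[of p q] p q by linarith
  then show ?case
    using insert.hyps coeff_mult_degree_bounds[OF p(1) q(1)] p q
    by (simp add: p_def[symmetric] q_def[symmetric])
qed simp

lemma degree_line_poly_le: "degree (line_poly f z v) \<le> total_deg f"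
  unfolding line_poly_def
proof (intro degree_sum_le ballI)
  fix m assume m: "m \<in> Poly_Mapping.keys f"
  have "degree (\<Prod>i\<in>UNIV. [:z $ i, of_real (v $ i):] ^ Poly_Mapping.lookup m i)
    \<le> (\<Sum>i\<in>UNIV. Poly_Mapping.lookup m i)"
    by (rule conjunct1[OF degree_coeff_linear_prod[OF finite]])
  also have "\<dots> \<le> total_deg f" unfolding total_deg_def using m by (intro Max_ge) auto
  finally show "degree (smult (Poly_Mapping.lookup f m)
      (\<Prod>i\<in>UNIV. [:z $ i, of_real (v $ i):] ^ Poly_Mapping.lookup m i)) \<le> total_deg f"
    using degree_smult_le order_trans by blast
qed simp

text \<open>On a line, a monomial of total degree \<open>s\<close> has degree at most
  \<open>s\<close> in the parameter, and its coefficient at \<open>s\<close> involves only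
  \<open>v\<close>. Hence the top coefficient is independent of \<open>z\<close>, and one condition
  on \<open>v\<close> fixes the degree for all base points.\<close>

lemma coeff_line_poly_total_deg: "coeff (line_poly f z v) (total_deg f) = lead_form f v"
  unfolding line_poly_def lead_form_def coeff_sum
proof (rule sum.cong[OF refl])
  fix m assume m: "m \<in> Poly_Mapping.keys f"
  define p where "p = (\<Prod>i\<in>UNIV. [:z $ i, of_real (v $ i):] ^ Poly_Mapping.lookup m i)"
  define s where "s = (\<Sum>i\<in>UNIV. Poly_Mapping.lookup m i)"
  have p: "degree p \<le> s" "coeff p s = (\<Prod>i\<in>UNIV. of_real (v $ i) ^ Poly_Mapping.lookup m i)"
    unfolding p_def s_def
    by (rule conjunct1[OF degree_coeff_linear_prod[OF finite]]
        conjunct2[OF degree_coeff_linear_prod[OF finite]])+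
  have "s \<le> total_deg f" unfolding total_deg_def s_def using m by (intro Max_ge) auto
  then have "coeff p (total_deg f) = 0" if "s \<noteq> total_deg f"
    using that p(1) by (intro coeff_eq_0) linarith
  then show "coeff (smult (Poly_Mapping.lookup f m) p) (total_deg f) =
    (if s = total_deg f then Poly_Mapping.lookup f m * (\<Prod>i\<in>UNIV. of_real (v $ i) ^ Poly_Mapping.lookup m i) else 0)"
    using p(2) by auto
qed

lemma degree_line_poly:
  assumes "lead_form f v \<noteq> 0"
  shows "degree (line_poly f z v) = total_deg f" and "line_poly f z v \<noteq> 0"
  using assms degree_line_poly_le[of f z v] coeff_line_poly_total_deg[of f z v]
    le_degree[of "line_poly f z v" "total_deg f"] by auto

lemma polyf_lead_form: "polyf UNIV (lead_form f)"
  unfolding lead_form_def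
  by (intro polyf_sum polyf_if polyf_mult polyf_prod polyf_power polyf_const polyf_var) auto

text \<open>Monomials are distinct multiplicative characters, hence linearly independent.\<close>

lemma monomials_independent:
  fixes c :: "('n::finite \<Rightarrow>\<^sub>0 nat) \<Rightarrow> complex"
  assumes "finite K" "\<And>x :: real ^ 'n. (\<Sum>m\<in>K. c m * (\<Prod>i\<in>UNIV. of_real (x $ i) ^ Poly_Mapping.lookup m i)) = 0"
  shows "\<forall>m\<in>K. c m = 0"
  using assms
proof (induction K arbitrary: c rule: finite_induct)
  case (insert k K)
  define mon :: "('n \<Rightarrow>\<^sub>0 nat) \<Rightarrow> real ^ 'n \<Rightarrow> complex" where
    "mon m x = (\<Prod>i\<in>UNIV. of_real (x $ i) ^ Poly_Mapping.lookup m i)" for m x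
  have mult: "mon m (\<chi> i. a $ i * x $ i) = mon m a * mon m x" for m a x
    by (simp add: mon_def power_mult_distrib prod.distrib)
  have 0: "(\<Sum>m\<in>K. c m * mon m x) = - (c k * mon k x)" for x
    using insert.prems[of x] insert.hyps by (simp add: mon_def eq_neg_iff_add_eq_0 add.commute)
  \<comment> \<open>Replacing \<open>x\<close> by its coordinatewise product with \<open>a\<close>
    and subtracting \<open>mon k a\<close> times the relation eliminates the monomial
    \<open>k\<close>, which leaves a shorter relation.\<close>
  have zero: "\<forall>m\<in>K. c m * (mon m a - mon k a) = 0" for a
  proof (rule insert.IH)
    fix x
    have "(\<Sum>m\<in>K. c m * (mon m a - mon k a) * mon m x)
      = (\<Sum>m\<in>K. c m * mon m (\<chi> i. a $ i * x $ i)) - mon k a * (\<Sum>m\<in>K. c m * mon m x)"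
      by (simp add: mult sum_distrib_left sum_subtractf algebra_simps)
    also have "\<dots> = 0" unfolding 0 by (simp add: mult)
    finally show "(\<Sum>m\<in>K. c m * (mon m a - mon k a) * (\<Prod>i\<in>UNIV. of_real (x $ i) ^ Poly_Mapping.lookup m i)) = 0"
      by (simp add: mon_def)
  qed
  have K: "c m = 0" if m: "m \<in> K" for m
  proof -
    have "m \<noteq> k" using m insert.hyps by auto
    then obtain i where i: "Poly_Mapping.lookup m i \<noteq> Poly_Mapping.lookup k i"
      by (meson poly_mapping_eqI)
    \<comment> \<open>The value 2 in a coordinate where the exponents differ separates the two
      monomials.\<close>
    define a :: "real ^ 'n" where "a = (\<chi> l. if l = i then 2 else 1)"
    have "mon l a = 2 ^ Poly_Mapping.lookup l i" for l
    proof -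
      have "mon l a = (\<Prod>j\<in>UNIV. if j = i then 2 ^ Poly_Mapping.lookup l i else 1)"
        unfolding mon_def by (rule prod.cong) (auto simp: a_def)
      then show ?thesis by simp
    qed
    moreover have "(2::complex) ^ Poly_Mapping.lookup m i \<noteq> 2 ^ Poly_Mapping.lookup k i"
    proof
      assume "(2::complex) ^ Poly_Mapping.lookup m i = 2 ^ Poly_Mapping.lookup k i"
      then have "norm ((2::complex) ^ Poly_Mapping.lookup m i) = norm ((2::complex) ^ Poly_Mapping.lookup k i)" by simp
      then show False using i by (simp add: norm_power)
    qed
    ultimately show ?thesis using zero[of a] m by auto
  qed
  moreover have "c k = 0" using 0[of "\<chi> i. 1"] K by (simp add: mon_def)
  ultimately show ?case by simp
qed simp

lemma lead_form_nonzero: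
  assumes "f \<noteq> 0"
  obtains v where "lead_form f v \<noteq> 0"
proof (rule ccontr)
  assume "\<not> thesis"
  with that have 0: "lead_form f v = 0" for v by blast
  define K where "K = {m \<in> Poly_Mapping.keys f. (\<Sum>i\<in>UNIV. Poly_Mapping.lookup m i) = total_deg f}"
  have "(\<Sum>m\<in>K. Poly_Mapping.lookup f m * (\<Prod>i\<in>UNIV. of_real (v $ i) ^ Poly_Mapping.lookup m i)) = 0" for v
    using 0[of v] unfolding lead_form_def K_def by (simp add: sum.inter_filter)
  then have "\<forall>m\<in>K. Poly_Mapping.lookup f m = 0"
    by (intro monomials_independent) (simp_all add: K_def)
  moreover have "total_deg f \<in> (\<lambda>m. \<Sum>i\<in>UNIV. Poly_Mapping.lookup m i) ` Poly_Mapping.keys f"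
    unfolding total_deg_def using assms by (intro Max_in) auto
  ultimately show False by (auto simp: K_def in_keys_iff)
qed

section \<open>Continuity of the restriction in base point and direction\<close>

lemma continuous_on_coeff_linear_power:
  fixes a b :: "'w::topological_space \<Rightarrow> complex"
  assumes "continuous_on S a" "continuous_on S b"
  shows "continuous_on S (\<lambda>w. coeff ([:a w, b w:] ^ n) k)"
proof (induction n arbitrary: k)
  case 0
  show ?case by simp
next
  case (Suc n)
  have "continuous_on S (\<lambda>w. coeff [:a w, b w:] j)" for j
    by (cases j; cases "j - 1") (auto intro: assms)
  then show ?case unfolding power_Suc coeff_mult by (intro continuous_intros Suc.IH)
qed

lemma continuous_on_coeff_prod:
  fixes P :: "'i \<Rightarrow> 'w::topological_space \<Rightarrow> complex poly"
  assumes "finite A" "\<And>i k. i \<in> A \<Longrightarrow> continuous_on S (\<lambda>w. coeff (P i w) k)"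
  shows "continuous_on S (\<lambda>w. coeff (\<Prod>i\<in>A. P i w) k)"
  using assms
proof (induction A arbitrary: k rule: finite_induct)
  case empty
  show ?case by simp
next
  case (insert i A)
  have "continuous_on S (\<lambda>w. coeff (P i w * (\<Prod>i\<in>A. P i w)) k)"
    unfolding coeff_mult by (intro continuous_intros insert) auto
  then show ?case using insert.hyps by simp
qed

lemma continuous_on_coeff_line_poly:
  assumes "continuous_on S z" "continuous_on S v"
  shows "continuous_on S (\<lambda>w. coeff (line_poly f (z w) (v w)) k)"
  unfolding line_poly_def coeff_sum coeff_smult
  by (intro continuous_intros continuous_on_coeff_prod continuous_on_coeff_linear_power assms) auto

section \<open>Complement components\<close>

definition cvec :: "real ^ 'n \<Rightarrow> real ^ 'n \<Rightarrow> complex ^ 'n" where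
  "cvec x y = (\<chi> i. Complex (x $ i) (y $ i))"

text \<open>The real part \<open>x\<close> of the base point is kept explicit; the count turns out
  to be independent of it when \<open>y\<close> lies outside the imaginary projection and the
  leading form does not vanish at \<open>v\<close>.\<close>

definition upper_roots :: "'n::finite cpoly \<Rightarrow> real ^ 'n \<Rightarrow> real ^ 'n \<Rightarrow> real ^ 'n \<Rightarrow> nat" where
  "upper_roots f x y v = roots_above 0 (line_poly f (cvec x y) v)"

lemma continuous_on_cvec [continuous_intros]:
  assumes "continuous_on S x" "continuous_on S y"
  shows "continuous_on S (\<lambda>w. cvec (x w) (y w))"
  unfolding cvec_def Complex_eq by (intro continuous_intros assms)

text \<open>Since \<open>v\<close> is real, only \<open>Im t\<close> affects the imaginary part of
  the point on the line. In particular a real root forces \<open>y\<close> itself into the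
  projection.\<close>

lemma line_poly_root_imp:
  assumes "poly (line_poly f (cvec x y) v) t = 0"
  shows "y + Im t *\<^sub>R v \<in> imaginary_projection f"
proof -
  define z where "z = (\<chi> i. cvec x y $ i + t * of_real (v $ i))"
  have "eval_cpoly f z = 0" using assms by (simp add: poly_line_poly z_def)
  moreover have "Im_vec z = y + Im t *\<^sub>R v"
    by (simp add: z_def Im_vec_def cvec_def vec_eq_iff)
  ultimately show ?thesis unfolding imaginary_projection_def by (metis (mono_tags, lifting) mem_Collect_eq)
qed

text \<open>The real part of a zero can serve as the real part \<open>x\<close> of the base point,
  which makes the parameter of that zero purely imaginary.\<close>

lemma imaginary_projection_root:
  assumes "y + s *\<^sub>R v \<in> imaginary_projection f"
  obtains x where "poly (line_poly f (cvec x y) v) (\<i> * of_real s) = 0"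
proof -
  obtain z where z: "eval_cpoly f z = 0" "y + s *\<^sub>R v = Im_vec z"
    using assms by (auto simp: imaginary_projection_def)
  have im: "Im (z $ i) = y $ i + s * v $ i" for i
    using arg_cong[OF z(2), of "\<lambda>w. w $ i"] by (simp add: Im_vec_def)
  have "(\<chi> i. cvec (\<chi> i. Re (z $ i)) y $ i + \<i> * of_real s * of_real (v $ i)) = z"
    by (simp add: vec_eq_iff cvec_def complex_eq_iff im)
  then have "poly (line_poly f (cvec (\<chi> i. Re (z $ i)) y) v) (\<i> * of_real s) = 0"
    using z(1) by (simp add: poly_line_poly)
  then show ?thesis by (rule that)
qed

section \<open>Constancy of the root count\<close>

text \<open>A nonzero leading form fixes the degree and \<open>y\<close> outside the projection
  excludes real roots, so the count is locally constant in base point and direction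
  together.\<close>

lemma upper_roots_const:
  assumes "connected T" and T: "\<And>x y v. (x, y, v) \<in> T \<Longrightarrow> y \<notin> imaginary_projection f \<and> lead_form f v \<noteq> 0"
    and "(x, y, v) \<in> T" "(x', y', v') \<in> T"
  shows "upper_roots f x y v = upper_roots f x' y' v'"
proof -
  define F where "F w = line_poly f (cvec (fst w) (fst (snd w))) (snd (snd w))" for w :: "(real^'a) \<times> (real^'a) \<times> (real^'a)"
  have cont: "continuous_on T (\<lambda>w. coeff (F w) k)" for k
    unfolding F_def by (intro continuous_on_coeff_line_poly continuous_intros)
  have F: "degree (F w) = total_deg f" "F w \<noteq> 0" if "w \<in> T" for w
  proof -
    have "lead_form f (snd (snd w)) \<noteq> 0" using T[of "fst w" "fst (snd w)" "snd (snd w)"] that by simp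
    then show "degree (F w) = total_deg f" "F w \<noteq> 0" unfolding F_def by (rule degree_line_poly)+
  qed
  have "roots_above 0 (F (x, y, v)) = roots_above 0 (F (x', y', v'))"
  proof (rule connected_local_const[OF assms(1,3,4)], rule ballI)
    fix w0 assume w0: "w0 \<in> T"
    define p where "p w = (if w \<in> T then F w else F w0)" for w
    have inT: "\<forall>\<^sub>F w in at w0 within T. w \<in> T" by (simp add: eventually_at_filter)
    have "\<forall>\<^sub>F w in at w0 within T. roots_above 0 (p w) = roots_above 0 (F w0)"
    proof (rule roots_above_locally_constant[of p "total_deg f"])
      fix k
      have "((\<lambda>w. coeff (F w) k) \<longlongrightarrow> coeff (F w0) k) (at w0 within T)"
        using cont w0 by (simp add: continuous_on_def)
      moreover have "\<forall>\<^sub>F w in at w0 within T. coeff (F w) k = coeff (p w) k"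
        using inT by eventually_elim (simp add: p_def)
      ultimately show "((\<lambda>w. coeff (p w) k) \<longlongrightarrow> coeff (F w0) k) (at w0 within T)"
        by (rule Lim_transform_eventually)
    next
      fix z assume "poly (F w0) z = 0"
      then have "fst (snd w0) + Im z *\<^sub>R snd (snd w0) \<in> imaginary_projection f"
        unfolding F_def by (rule line_poly_root_imp)
      moreover have "fst (snd w0) \<notin> imaginary_projection f"
        using T[of "fst w0" "fst (snd w0)" "snd (snd w0)"] w0 by simp
      ultimately show "Im z \<noteq> 0" by auto
    qed (use F w0 in \<open>auto simp: p_def\<close>)
    with inT show "\<forall>\<^sub>F w in at w0 within T. roots_above 0 (F w0) = roots_above 0 (F w)"
      by eventually_elim (simp add: p_def)
  qed
  then show ?thesis by (simp add: upper_roots_def F_def)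
qed

text \<open>The product with the whole real space is connected too, so the count does not depend on
  the real part of the base point either.\<close>

lemma upper_roots_const_prod:
  assumes "connected C" "connected S" "C \<inter> imaginary_projection f = {}" "\<And>v. v \<in> S \<Longrightarrow> lead_form f v \<noteq> 0"
    and "y \<in> C" "y' \<in> C" "v \<in> S" "v' \<in> S"
  shows "upper_roots f x y v = upper_roots f x' y' v'"
proof (rule upper_roots_const)
  show "connected ((UNIV :: (real ^ 'a) set) \<times> C \<times> S)"
    by (intro connected_Times assms convex_connected convex_UNIV)
qed (use assms in auto)

text \<open>Shifting the base point by \<open>\<i> v\<close> shifts the roots by \<open>-\<i>\<close>, so that equality of the two root
  counts leaves no root in the strip between them.\<close>

lemma segment_avoids_imaginary_projection:
  assumes "lead_form f v \<noteq> 0" "y \<notin> imaginary_projection f" "y + v \<notin> imaginary_projection f"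
    and eq: "upper_roots f 0 y v = upper_roots f 0 (y + v) v"
    and s: "0 \<le> s" "s \<le> 1"
  shows "y + s *\<^sub>R v \<notin> imaginary_projection f"
proof
  assume "y + s *\<^sub>R v \<in> imaginary_projection f"
  then obtain x where x: "poly (line_poly f (cvec x y) v) (\<i> * of_real s) = 0"
    by (rule imaginary_projection_root)
  have "s \<noteq> 0" using line_poly_root_imp[OF x] assms(2) by auto
  define p where "p = line_poly f (cvec x y) v"
  have "p \<noteq> 0" unfolding p_def by (rule degree_line_poly[OF assms(1)])
  have "poly (line_poly f (cvec x (y + v)) v) t = poly (pcompose p [:\<i>, 1:]) t" for t
  proof -
    have "(\<chi> i. cvec x (y + v) $ i + t * of_real (v $ i)) = (\<chi> i. cvec x y $ i + (\<i> + t) * of_real (v $ i))"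
      by (simp add: vec_eq_iff cvec_def complex_eq_iff algebra_simps)
    then show ?thesis by (simp add: p_def poly_line_poly poly_pcompose)
  qed
  then have shift: "line_poly f (cvec x (y + v)) v = pcompose p [:\<i>, 1:]"
    using poly_eq_poly_eq_iff by blast
  \<comment> \<open>The zero was found over some real part \<open>x\<close>, while the hypothesis
    compares counts over \<open>0\<close>.\<close>
  have indep: "upper_roots f x u v = upper_roots f 0 u v" if "u \<notin> imaginary_projection f" for u
    by (rule upper_roots_const_prod[of "{u}" "{v}"]) (use that assms(1) in auto)
  have "roots_above 0 p = roots_above 0 (pcompose p [:\<i>, 1:])"
    using eq indep[OF assms(2)] indep[OF assms(3)] shift by (simp add: upper_roots_def p_def)
  then have "roots_above 0 p = roots_above 1 p"
    using roots_above_pcompose_shift[OF \<open>p \<noteq> 0\<close>, of 0] by simp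
  then have "poly p (\<i> * of_real s) \<noteq> 0"
    by (rule roots_above_eq_imp_no_root[OF \<open>p \<noteq> 0\<close>]) (use s \<open>s \<noteq> 0\<close> in auto)
  then show False using x by (simp add: p_def)
qed

text \<open>\<open>E\<close> is only dense, so \<open>y' - y\<close> is replaced by a nearby
  \<open>v\<close> in \<open>E\<close>, and openness of \<open>C\<close> and \<open>C'\<close>
  absorbs the error. The same room shows that a whole ball around the point avoids the projection,
  which places the point outside the closure.\<close>

lemma open_sets_segment_subset:
  fixes f :: "'n::finite cpoly"
  assumes "open C" "open C'" "C \<inter> imaginary_projection f = {}" "C' \<inter> imaginary_projection f = {}"
    and dense: "closure E = UNIV" and E: "\<And>v. v \<in> E \<Longrightarrow> lead_form f v \<noteq> 0"
    and eq: "\<And>y y' v. y \<in> C \<Longrightarrow> y' \<in> C' \<Longrightarrow> v \<in> E \<Longrightarrow> upper_roots f 0 y v = upper_roots f 0 y' v"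
    and y: "y \<in> C" "y' \<in> C'"
  shows "closed_segment y y' \<subseteq> - closure (imaginary_projection f)"
proof
  fix z assume "z \<in> closed_segment y y'"
  then obtain s where s: "0 \<le> s" "s \<le> 1" "z = y + s *\<^sub>R (y' - y)"
    by (auto simp: closed_segment_def algebra_simps)
  obtain e1 where e1: "e1 > 0" "ball y e1 \<subseteq> C" using assms(1) y(1) by (meson openE)
  obtain e2 where e2: "e2 > 0" "ball y' e2 \<subseteq> C'" using assms(2) y(2) by (meson openE)
  define e where "e = min e1 e2"
  have e: "e > 0" "ball y e \<subseteq> C" "ball y' e \<subseteq> C'"
    using e1 e2 subset_ball[of e e1] subset_ball[of e e2] by (auto simp: e_def)
  have "y' - y \<in> closure E" using dense by simp
  then obtain v where v: "v \<in> E" "dist v (y' - y) < e / 2"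
    unfolding closure_approachable using e(1) by (meson half_gt_zero)
  define u where "u = v - (y' - y)"
  have u: "norm u < e / 2" using v(2) by (simp add: u_def dist_norm)
  have "a \<notin> imaginary_projection f" if a: "a \<in> ball z (e / 2)" for a
  proof -
    \<comment> \<open>\<open>w\<close> is chosen with \<open>y + w + s *\<^sub>R v = a\<close>, so
      \<open>a\<close> lies on the segment from \<open>y + w\<close> in \<open>C\<close> to
      \<open>y + w + v\<close> in \<open>C'\<close>.\<close>
    define w where "w = a - z - s *\<^sub>R u"
    have na: "norm (a - z) < e / 2" using a by (simp add: dist_norm norm_minus_commute)
    have su: "norm (s *\<^sub>R u) < e / 2" "norm ((1 - s) *\<^sub>R u) < e / 2"
      using u s mult_left_le_one_le[of "norm u" s] mult_left_le_one_le[of "norm u" "1 - s"] by auto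
    have "norm w < e" unfolding w_def using norm_triangle_ineq4[of "a - z" "s *\<^sub>R u"] na su by linarith
    then have C: "y + w \<in> C" using e(2) by (auto simp: dist_norm)
    have "norm (w + u) < e"
    proof -
      have "w + u = (a - z) + (1 - s) *\<^sub>R u" by (simp add: w_def algebra_simps)
      then show ?thesis using norm_triangle_ineq[of "a - z" "(1 - s) *\<^sub>R u"] na su by simp
    qed
    then have "y' + (w + u) \<in> ball y' e"
      unfolding mem_ball dist_norm norm_minus_commute[of y'] add_diff_cancel_left' .
    then have "y' + (w + u) \<in> C'" using e(3) by blast
    moreover have "y' + (w + u) = y + w + v" by (simp add: u_def)
    ultimately have C': "y + w + v \<in> C'" by simp
    have "(y + w) + s *\<^sub>R v \<notin> imaginary_projection f"
      by (rule segment_avoids_imaginary_projection[OF E[OF v(1)] _ _ eq[OF C C' v(1)] s(1,2)])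
        (use C C' assms(3,4) in auto)
    moreover have "(y + w) + s *\<^sub>R v = a" by (simp add: w_def u_def s(3) algebra_simps)
    ultimately show ?thesis by simp
  qed
  then have "ball z (e / 2) \<inter> imaginary_projection f = {}" by blast
  then have "ball z (e / 2) \<inter> closure (imaginary_projection f) = {}"
    by (simp add: open_Int_closure_eq_empty)
  moreover have "z \<in> ball z (e / 2)" using e(1) by simp
  ultimately show "z \<in> - closure (imaginary_projection f)" by blast
qed

theorem theorem4p1:
  fixes f :: "'n::finite cpoly"
  shows "(\<forall>C \<in> components (- closure (imaginary_projection f)). convex C) \<and>
         finite (components (- closure (imaginary_projection f)))"
proof (cases "f = 0")
  case True
  \<comment> \<open>The zero polynomial vanishes everywhere, so the complement is empty and has no
    components.\<close>
  then have "imaginary_projection f = range Im_vec"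
    by (auto simp: imaginary_projection_def eval_cpoly_def)
  moreover have "surj (Im_vec :: complex ^ 'n \<Rightarrow> _)"
    by (rule surjI[of _ "\<lambda>y. \<chi> i. Complex 0 (y $ i)"]) (simp add: Im_vec_def)
  ultimately show ?thesis by simp
next
  case False
  define A where "A = - closure (imaginary_projection f)"
  have openA: "open A" unfolding A_def by (rule open_Compl[OF closed_closure])
  obtain v0 where "lead_form f v0 \<noteq> 0" using lead_form_nonzero[OF False] .
  \<comment> \<open>The cells are taken in the space of directions, not of points.\<close>
  from polyf_cells[OF finite polyf_lead_form this]
  obtain \<S> where fin: "finite \<S>" and dense: "closure (\<Union>\<S>) = UNIV"
    and S: "\<And>S. S \<in> \<S> \<Longrightarrow> connected S \<and> (\<forall>v\<in>S. lead_form f v \<noteq> 0)"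
    by auto
  have C: "open C" "connected C" "C \<inter> imaginary_projection f = {}" "C \<subseteq> A" if "C \<in> components A" for C
    using that openA open_components[of A C] in_components_connected[of C A] in_components_subset[of C A]
      closure_subset[of "imaginary_projection f"] by (auto simp: A_def)
  have const: "upper_roots f 0 y v = upper_roots f 0 y' v'"
    if "C \<in> components A" "S \<in> \<S>" "y \<in> C" "y' \<in> C" "v \<in> S" "v' \<in> S" for C S y y' v v'
    by (rule upper_roots_const_prod[of C S]) (use that C S in auto)
  have seg: "closed_segment y y' \<subseteq> A"
    if "C \<in> components A" "C' \<in> components A" "y \<in> C" "y' \<in> C'"
      and "\<And>y y' v. y \<in> C \<Longrightarrow> y' \<in> C' \<Longrightarrow> v \<in> \<Union>\<S> \<Longrightarrow> upper_roots f 0 y v = upper_roots f 0 y' v"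
    for C C' y y'
    unfolding A_def
    by (rule open_sets_segment_subset[OF C(1)[OF that(1)] C(1)[OF that(2)] C(3)[OF that(1)] C(3)[OF that(2)]
          dense _ that(5,3,4)]) (use S in auto)
  have join: "closed_segment y y' \<subseteq> C"
    if "C \<in> components A" "y \<in> C" "closed_segment y y' \<subseteq> A" for C y y'
    by (rule components_maximal[OF that(1) connected_segment(1) that(3)]) (use that(2) in auto)
  have "convex C" if "C \<in> components A" for C
    unfolding convex_contains_segment
  proof (intro ballI)
    fix y y' assume y: "y \<in> C" "y' \<in> C"
    have "closed_segment y y' \<subseteq> A" by (rule seg[OF that that y]) (use const that in blast)
    then show "closed_segment y y' \<subseteq> C" by (rule join[OF that y(1)])
  qed
  moreover have "finite (components A)"
  proof -
    \<comment> \<open>The code of a component lists its root count for each cell of directions. For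
      a nonempty cell the choices by \<open>SOME\<close> are immaterial, and all values are bounded
      by the total degree, so only finitely many codes are possible.\<close>
    define code where "code C = (\<lambda>S\<in>\<S>. upper_roots f 0 (SOME y. y \<in> C) (SOME v. v \<in> S))" for C
    have code: "code C S = upper_roots f 0 y v"
      if "C \<in> components A" "S \<in> \<S>" "y \<in> C" "v \<in> S" for C S y v
    proof -
      have "(SOME y. y \<in> C) \<in> C" "(SOME v. v \<in> S) \<in> S" using that by (auto intro: someI)
      then have "upper_roots f 0 (SOME y. y \<in> C) (SOME v. v \<in> S) = upper_roots f 0 y v"
        by (intro const[OF that(1,2)] that)
      then show ?thesis using that(2) by (simp add: code_def)
    qed
    have "code ` components A \<subseteq> (\<Pi>\<^sub>E S\<in>\<S>. {..total_deg f})"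
    proof -
      have "upper_roots f 0 y v \<le> total_deg f" for y v
        unfolding upper_roots_def by (rule order_trans[OF roots_above_le degree_line_poly_le])
      then show ?thesis by (auto simp: code_def)
    qed
    moreover have "finite (\<Pi>\<^sub>E S\<in>\<S>. {..total_deg f})" by (intro finite_PiE fin) auto
    moreover have "inj_on code (components A)"
    proof (rule inj_onI)
      fix C C' assume CC: "C \<in> components A" "C' \<in> components A" "code C = code C'"
      obtain y y' where y: "y \<in> C" "y' \<in> C'" using CC(1,2) in_components_nonempty by blast
      have "closed_segment y y' \<subseteq> A"
      proof (rule seg[OF CC(1,2) y])
        fix y y' v assume "y \<in> C" "y' \<in> C'" "v \<in> \<Union>\<S>"
        then show "upper_roots f 0 y v = upper_roots f 0 y' v" using code CC by (metis UnionE)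
      qed
      then have "y' \<in> C" using join[OF CC(1) y(1)] by auto
      then show "C = C'" using y(2) CC(1,2) components_nonoverlap by blast
    qed
    ultimately show ?thesis by (meson finite_subset finite_imageD)
  qed
  ultimately show ?thesis by (simp add: A_def)
qed

end
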